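(* Consider an $(\mathsf M,n)=(2,2)$ WPIR scheme (two files, two servers) that satisfies, for $l=1,2$ and some positive $\alpha\in\mathbb N$, $$|\mathcal Q_l|\le\alpha<\infty,\qquad|\mathcal A_l|\le|\mathcal X|^\beta,$$ and with maximal leakage $\rho^{(\mathsf{MaxL})}\le\rho\le1$. Then the maximum possible WPIR rate is $$\mathsf R^{(\mathsf{MaxL})}_{\max}(\rho)=\Bigl[\frac52-2^\rho\Bigr]^{-1}.$$ Moreover, assuming that only one of the two servers can leak information, the maximum possible WPIR rate is $$\mathsf R^{(\mathsf{MaxL})}_{\max}(\rho)=\bigl[2-2^{\rho-1}\bigr]^{-1}.$$
   Context: An $(\mathsf M,n)$ IR (information retrieval) scheme (here $\mathsf M=n=2$): $n$ noncolluding servers each store the same $\mathsf M$ independent files $X^{(1)},\dots,X^{(\mathsf M)}$, each uniform on $\mathcal X^\beta$ ($\beta$ is the file size); the requested index $M$ is uniform on $\{1,\dots,\mathsf M\}$. The scheme $\mathscr C$ consists of: a random strategy $S$; queries $Q_l=\phi_l(M,S)$ with alphabet $\mathcal Q_l$ sent to server $l$; answer-length functions $\ell_l:\mathcal Q_l\to\{0,1,\dots\}$; answers $A_l=\varphi_l(Q_l,X^{(1)},\dots,X^{(\mathsf M)})\in\mathcal A^{\ell_l(Q_l)}$; such that $H(X^{(M)}\mid A_1,\dots,A_n,Q_1,\dots,Q_n,M)=0$. The queries are assumed independent of the files. $\mathcal A_l$ denotes the alphabet of the answer $A_l$. A weakly-private information retrieval (WPIR) scheme is an IR scheme in which perfect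 privacy (i.e. independence of $M$ and $Q_l$ for every $l$) is not required to hold, so that some information on $M$ may leak to the servers. Rate: $\mathsf R(\mathscr C)=\beta\log_2|\mathcal X|/\mathsf D(\mathscr C)$ with $\mathsf D(\mathscr C)=\log_2|\mathcal A|\sum_{l=1}^n\mathbb E[\ell_l(Q_l)]$. The maximal leakage at server $l$ is $\log_2\sum_{q\in\mathcal Q_l}\max_{m}P_{Q_l|M}(q|m)$, and $\rho^{(\mathsf{MaxL})}(\mathscr C)$ is its maximum over $l$. "Only one of the two servers can leak" means that the leakage at the other server is $0$. Convention for the converse part: the file size $\beta$ is allowed to go to infinity (with $\alpha$ the bound on the query alphabet sizes).
   Formalization: The first formula is proved for 0 ≤ ρ ≤ log₂(3/2); for log₂(3/2) < ρ ≤ 1 it would exceed 1, which no scheme can achieve, and the maximum is proved to be 1 instead. The query bound α is any sufficiently large integer, and the maximum is approached as β→∞. *)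

theory Defs
  imports "HOL-Probability.Probability" "HOL-Library.Infinite_Typeclass"
begin

definition words :: "nat \<Rightarrow> 'c set \<Rightarrow> 'c list set" where
  "words k C = {w. set w \<subseteq> C \<and> length w = k}"

text \<open>
  The data of an information retrieval scheme. Files are indexed by \<open>1, \<dots>, num_files\<close> and
  servers by \<open>1, \<dots>, num_servers\<close>. The random strategy \<open>S\<close> is given by its law, an
  arbitrary probability space; \<open>query_map C l m s\<close> is $\phi_l(m,s)$ and \<open>answer_map C l q F\<close>
  is $\varphi_l(q,F(1),F(2),\dots)$.
\<close>

record ('s, 'q, 'x, 'a) ir_scheme =
  num_files :: nat
  num_servers :: nat
  file_alphabet :: "'x set"
  file_size :: nat
  strategy :: "'s measure"
  query_alphabet :: "nat \<Rightarrow> 'q set"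
  query_map :: "nat \<Rightarrow> nat \<Rightarrow> 's \<Rightarrow> 'q"
  answer_length :: "nat \<Rightarrow> 'q \<Rightarrow> nat"
  answer_symbols :: "'a set"
  answer_map :: "nat \<Rightarrow> 'q \<Rightarrow> (nat \<Rightarrow> 'x list) \<Rightarrow> 'a list"

definition file_tuples :: "('s, 'q, 'x, 'a) ir_scheme \<Rightarrow> (nat \<Rightarrow> 'x list) set" where
  "file_tuples C =
     (\<Pi>\<^sub>E m\<in>{1..num_files C}. words (file_size C) (file_alphabet C))"

text \<open>
  The sample space carries the triple (requested index, strategy, files). As a product space it
  makes the three components independent; the uniform law on \<open>file_tuples C\<close> makes the files
  independent and uniform.
\<close>

type_synonym ('s, 'x) outcome = "nat \<times> 's \<times> (nat \<Rightarrow> 'x list)"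

definition ir_space :: "('s, 'q, 'x, 'a) ir_scheme \<Rightarrow> ('s, 'x) outcome measure" where
  "ir_space C =
     uniform_count_measure {1..num_files C} \<Otimes>\<^sub>M
       (strategy C \<Otimes>\<^sub>M uniform_count_measure (file_tuples C))"

definition requested_index :: "('s, 'x) outcome \<Rightarrow> nat" where
  "requested_index = (\<lambda>(m, s, F). m)"

definition requested_file :: "('s, 'x) outcome \<Rightarrow> 'x list" where
  "requested_file = (\<lambda>(m, s, F). F m)"

definition query :: "('s, 'q, 'x, 'a) ir_scheme \<Rightarrow> nat \<Rightarrow> ('s, 'x) outcome \<Rightarrow> 'q" where
  "query C l = (\<lambda>(m, s, F). query_map C l m s)"

definition answer :: "('s, 'q, 'x, 'a) ir_scheme \<Rightarrow> nat \<Rightarrow> ('s, 'x) outcome \<Rightarrow> 'a list" where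
  "answer C l = (\<lambda>(m, s, F). answer_map C l (query_map C l m s) F)"

definition retrieved ::
  "('s, 'q, 'x, 'a) ir_scheme \<Rightarrow> ('s, 'x) outcome \<Rightarrow> (nat \<Rightarrow> 'a list) \<times> (nat \<Rightarrow> 'q) \<times> nat" where
  "retrieved C \<omega> =
     (\<lambda>l\<in>{1..num_servers C}. answer C l \<omega>,
      \<lambda>l\<in>{1..num_servers C}. query C l \<omega>,
      requested_index \<omega>)"

text \<open>
  This is the library notation for conditional entropy of simple random variables, in bits,
  available there only inside the locale \<open>information_space\<close>.
\<close>

definition cond_entropy :: "'w measure \<Rightarrow> ('w \<Rightarrow> 'b) \<Rightarrow> ('w \<Rightarrow> 'c) \<Rightarrow> real" where
  "cond_entropy P X Y =
     prob_space.conditional_entropy P 2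
       (count_space (X ` space P)) (count_space (Y ` space P)) X Y"

text \<open>
  No privacy requirement is included, so these are exactly the weakly-private schemes.
\<close>

definition ir_scheme :: "('s, 'q, 'x, 'a) ir_scheme \<Rightarrow> bool" where
  "ir_scheme C \<longleftrightarrow>
     1 \<le> num_files C \<and> 1 \<le> num_servers C \<and>
     finite (file_alphabet C) \<and> 2 \<le> card (file_alphabet C) \<and> 1 \<le> file_size C \<and>
     prob_space (strategy C) \<and>
     finite (answer_symbols C) \<and> answer_symbols C \<noteq> {} \<and>
     (\<forall>l\<in>{1..num_servers C}.
        finite (query_alphabet C l) \<and>
        (\<forall>m\<in>{1..num_files C}.
           query_map C l m \<in> strategy C \<rightarrow>\<^sub>M count_space (query_alphabet C l)) \<and>
        (\<forall>q\<in>query_alphabet C l. \<forall>F\<in>file_tuples C.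
           answer_map C l q F \<in> words (answer_length C l q) (answer_symbols C))) \<and>
     cond_entropy (ir_space C) requested_file (retrieved C) = 0"

definition download_cost :: "('s, 'q, 'x, 'a) ir_scheme \<Rightarrow> real" where
  "download_cost C =
     log 2 (real (card (answer_symbols C))) *
     (\<Sum>l\<in>{1..num_servers C}.
        (\<integral>\<omega>. real (answer_length C l (query C l \<omega>)) \<partial>ir_space C))"

definition rate :: "('s, 'q, 'x, 'a) ir_scheme \<Rightarrow> real" where
  "rate C =
     real (file_size C) * log 2 (real (card (file_alphabet C))) / download_cost C"

definition leakage :: "('s, 'q, 'x, 'a) ir_scheme \<Rightarrow> nat \<Rightarrow> real" where
  "leakage C l =
     log 2 (\<Sum>q\<in>query_alphabet C l. Max ((\<lambda>m.
        \<P>(\<omega> in ir_space C. query C l \<omega> = q \<bar> requested_index \<omega> = m)) ` {1..num_files C}))"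

definition max_leakage :: "('s, 'q, 'x, 'a) ir_scheme \<Rightarrow> real" where
  "max_leakage C = Max (leakage C ` {1..num_servers C})"

definition answer_alphabet :: "('s, 'q, 'x, 'a) ir_scheme \<Rightarrow> nat \<Rightarrow> 'a list set" where
  "answer_alphabet C l =
     (\<Union>q\<in>query_alphabet C l. words (answer_length C l q) (answer_symbols C))"

text \<open>
  The empty word is the answer of length \<open>0\<close>, for which the server sends nothing.
\<close>

definition transmitted_answers :: "('s, 'q, 'x, 'a) ir_scheme \<Rightarrow> nat \<Rightarrow> 'a list set" where
  "transmitted_answers C l = answer_alphabet C l - {[]}"

definition wpir_2_2 ::
  "(('s, 'q, 'x, 'a) ir_scheme \<Rightarrow> nat \<Rightarrow> 'a list set) \<Rightarrow>
   'x set \<Rightarrow> nat \<Rightarrow> nat \<Rightarrow> ('s, 'q, 'x, 'a) ir_scheme set" where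
  "wpir_2_2 alph \<X> \<alpha> \<beta> =
     {C. ir_scheme C \<and> num_files C = 2 \<and> num_servers C = 2 \<and>
         file_alphabet C = \<X> \<and> file_size C = \<beta> \<and>
         (\<forall>l\<in>{1, 2}. card (query_alphabet C l) \<le> \<alpha> \<and> card (alph C l) \<le> card \<X> ^ \<beta>)}"

text \<open>
  \<open>c\<close> is the maximum possible rate, under the leakage constraint \<open>L\<close>, for query alphabets of
  size at most \<open>\<alpha>\<close> when the file size may grow: no scheme exceeds \<open>c\<close> at any file size, and
  some sequence of schemes, one for each large \<open>\<beta>\<close>, has rates tending to \<open>c\<close>. If the word
  \<open>[]\<close>, which is never transmitted, does not count towards the size of the answer alphabet,
  then \<open>c\<close> is the greatest element of the set of rates for every single \<open>\<beta>\<close>. If it counts, an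
  optimal scheme using both \<open>[]\<close> and all words carrying one full file exceeds the bound
  \<open>card \<X> ^ \<beta>\<close> by one, and \<open>c\<close> is in general only approached.
\<close>

definition is_max_rate ::
  "'x set \<Rightarrow> nat \<Rightarrow> (('s, 'q, 'x, 'a) ir_scheme \<Rightarrow> bool) \<Rightarrow> real \<Rightarrow> bool" where
  "is_max_rate \<X> \<alpha> L c \<longleftrightarrow>
     (\<forall>\<beta>\<ge>1. \<forall>C\<in>wpir_2_2 answer_alphabet \<X> \<alpha> \<beta>. L C \<longrightarrow> rate C \<le> c) \<and>
     (\<exists>C. (\<forall>\<^sub>F \<beta> in sequentially.
             C \<beta> \<in> wpir_2_2 answer_alphabet \<X> \<alpha> \<beta> \<and> L (C \<beta>)) \<and>
          (\<lambda>\<beta>. rate (C \<beta>)) \<longlonglongrightarrow> c) \<and>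
     (\<forall>\<beta>\<ge>1. (\<exists>C\<in>wpir_2_2 transmitted_answers \<X> \<alpha> \<beta>. L C \<and> rate C = c) \<and>
            (\<forall>C\<in>wpir_2_2 transmitted_answers \<X> \<alpha> \<beta>. L C \<longrightarrow> rate C \<le> c))"

end

theory Submission
  imports Defs
begin

text \<open>
  Write \<open>K l\<close> for the sum over all queries \<open>q\<close> of the larger of the two probabilities of \<open>q\<close> at
  server \<open>l\<close>, so that the leakage at \<open>l\<close> is \<open>log 2 (K l)\<close>, and \<open>L\<close> for the number of bits of a file.
  For the converse, let \<open>h l q\<close> be the average, over the values of file 1, of the logarithm of the
  number of answers of server \<open>l\<close> to \<open>q\<close> that remain possible; as only lengths of answers are to be
  bounded, this can replace the conditional entropy given file 1. When file 1 is requested, the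
  answers carry its \<open>L\<close> bits and on top of these at least \<open>h l q\<close> bits for either server; when file 2
  is requested, \<open>h 1 q + h 2 q'\<close> is at least \<open>L\<close> because file 2 can be decoded. Since \<open>h l\<close> lies
  between \<open>0\<close> and \<open>L\<close>, its expectations under the two requests differ by at most \<open>L * (K l - 1)\<close>.
  Averaging over the servers and exchanging the files bounds the download cost from below by
  \<open>L * (5 / 2 - (K 1 + K 2) / 2)\<close>.

  The bound is attained by the scheme in which a server is sent nothing, one of the files, or the
  sum of both: to get file 1, either request it from one server and nothing from the other, or
  request file 2 from one server and the sum from the other. The cheap first option is given more
  weight than privacy permits.
\<close>

subsection \<open>Laws of the queries and decodability\<close>

lemma finite_words: "finite A \<Longrightarrow> finite (words k A)"
  unfolding words_def by (rule finite_lists_length_eq)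

lemma card_words: "finite A \<Longrightarrow> card (words k A) = card A ^ k"
  unfolding words_def by (rule card_lists_length_eq)

text \<open>The conditional entropy is a finite sum of terms -p(x,y) log(p(x,y)/p(y)). No term is
  negative since p(x,y) <= p(y), and a term vanishes only for p(x,y) = 0 or p(x,y) = p(y).\<close>

lemma (in information_space) conditional_entropy_eq_0_iff:
  assumes X: "simple_function M X" and Y: "simple_function M Y"
  shows "conditional_entropy b (count_space (X ` space M)) (count_space (Y ` space M)) X Y = 0 \<longleftrightarrow>
    (\<forall>\<omega>\<in>space M. prob {\<eta>\<in>space M. X \<eta> = X \<omega> \<and> Y \<eta> = Y \<omega>} = 0 \<or>
       prob {\<eta>\<in>space M. X \<eta> = X \<omega> \<and> Y \<eta> = Y \<omega>} = prob {\<eta>\<in>space M. Y \<eta> = Y \<omega>})"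
proof -
  define Py where "Py y = measure M (Y -` {y} \<inter> space M)" for y
  define Pxy where "Pxy z = measure M ((\<lambda>x. (X x, Y x)) -` {z} \<inter> space M)" for z
  have XY: "simple_function M (\<lambda>x. (X x, Y x))"
    using X Y by (rule simple_function_Pair)
  have sY: "simple_distributed M Y Py"
    by (rule simple_distributedI[OF Y]) (auto simp: Py_def)
  have sXY: "simple_distributed M (\<lambda>x. (X x, Y x)) Pxy"
    by (rule simple_distributedI[OF XY]) (auto simp: Pxy_def)
  have fin: "finite ((\<lambda>x. (X x, Y x)) ` space M)"
    using XY by (rule simple_functionD)
  have sets_Y: "Y -` {y} \<inter> space M \<in> events" for y
    using Y by (rule simple_functionD)
  have le: "Pxy (x, y) \<le> Py y" for x y
    unfolding Pxy_def Py_def by (rule finite_measure_mono) (auto intro: sets_Y)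
  have nn: "0 \<le> Pxy z" for z
    by (simp add: Pxy_def)
  have entropy_term: "0 \<le> - (Pxy (x, y) * log b (Pxy (x, y) / Py y)) \<and>
      (- (Pxy (x, y) * log b (Pxy (x, y) / Py y)) = 0 \<longleftrightarrow> Pxy (x, y) = 0 \<or> Pxy (x, y) = Py y)"
    for x y
  proof (cases "Pxy (x, y) = 0")
    case False
    then have pos: "0 < Pxy (x, y)" using nn[of "(x, y)"] by linarith
    then have pos': "0 < Py y" using le[of x y] by linarith
    have "log b (Pxy (x, y) / Py y) \<le> 0"
      using pos pos' le[of x y] b_gt_1 by (simp add: log_divide)
    moreover have "log b (Pxy (x, y) / Py y) = 0 \<longleftrightarrow> Pxy (x, y) = Py y"
      using pos pos' b_gt_1 by (auto simp: log_divide dest: inj_onD[OF log_inj[OF b_gt_1]])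
    ultimately show ?thesis using pos by (simp add: mult_nonneg_nonpos)
  qed simp
  have "conditional_entropy b (count_space (X ` space M)) (count_space (Y ` space M)) X Y =
     (\<Sum>z\<in>(\<lambda>x. (X x, Y x)) ` space M. - (Pxy z * log b (Pxy z / Py (snd z))))"
    by (simp add: conditional_entropy_eq[OF sY sXY] sum_negf split_beta')
  also have "\<dots> = 0 \<longleftrightarrow>
      (\<forall>z\<in>(\<lambda>x. (X x, Y x)) ` space M. - (Pxy z * log b (Pxy z / Py (snd z))) = 0)"
    by (rule sum_nonneg_eq_0_iff[OF fin]) (use entropy_term in force)
  also have "\<dots> \<longleftrightarrow> (\<forall>\<omega>\<in>space M. Pxy (X \<omega>, Y \<omega>) = 0 \<or> Pxy (X \<omega>, Y \<omega>) = Py (Y \<omega>))"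
    using entropy_term by auto
  finally have "conditional_entropy b (count_space (X ` space M)) (count_space (Y ` space M)) X Y = 0 \<longleftrightarrow>
      (\<forall>\<omega>\<in>space M. Pxy (X \<omega>, Y \<omega>) = 0 \<or> Pxy (X \<omega>, Y \<omega>) = Py (Y \<omega>))" .
  moreover have "Pxy (X \<omega>, Y \<omega>) = prob {\<eta>\<in>space M. X \<eta> = X \<omega> \<and> Y \<eta> = Y \<omega>}" for \<omega>
    unfolding Pxy_def by (rule arg_cong[where f=prob]) auto
  moreover have "Py (Y \<omega>) = prob {\<eta>\<in>space M. Y \<eta> = Y \<omega>}" for \<omega>
    unfolding Py_def by (rule arg_cong[where f=prob]) auto
  ultimately show ?thesis by simp
qed

text \<open>Decodability and all conditions on answers are left out. The laws of the queries are
  thus available while the scheme of the achievability part is still being shown to be an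
  \<open>ir_scheme\<close>.\<close>

locale query_scheme =
  fixes C :: "('s, 'q, 'x, 'a) ir_scheme"
  assumes num_files_ge: "1 \<le> num_files C"
    and finite_files: "finite (file_alphabet C)"
    and files_nonempty: "file_alphabet C \<noteq> {}"
    and prob_strategy: "prob_space (strategy C)"
    and finite_queries: "l \<in> {1..num_servers C} \<Longrightarrow> finite (query_alphabet C l)"
    and measurable_query_map:
      "l \<in> {1..num_servers C} \<Longrightarrow> m \<in> {1..num_files C} \<Longrightarrow>
        query_map C l m \<in> strategy C \<rightarrow>\<^sub>M count_space (query_alphabet C l)"
begin

section \<open>The probability space of outcomes and the laws of the queries\<close>

sublocale S: prob_space "strategy C"
  by (rule prob_strategy)

lemma query_in_alphabet:
  "l \<in> {1..num_servers C} \<Longrightarrow> m \<in> {1..num_files C} \<Longrightarrow> s \<in> space (strategy C) \<Longrightarrow>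
    query_map C l m s \<in> query_alphabet C l"
  using measurable_space[OF measurable_query_map] by auto

lemma sets_query:
  assumes "l \<in> {1..num_servers C}" "m \<in> {1..num_files C}"
  shows "{s \<in> space (strategy C). query_map C l m s = q} \<in> sets (strategy C)"
proof (cases "q \<in> query_alphabet C l")
  case True
  have "query_map C l m -` {q} \<inter> space (strategy C) \<in> sets (strategy C)"
    by (rule measurable_sets[OF measurable_query_map[OF assms]]) (use True in simp)
  also have "query_map C l m -` {q} \<inter> space (strategy C) =
      {s \<in> space (strategy C). query_map C l m s = q}" by auto
  finally show ?thesis .
next
  case False
  then have "{s \<in> space (strategy C). query_map C l m s = q} = {}"
    using query_in_alphabet[OF assms] by auto
  then show ?thesis by (simp only: sets.empty_sets)
qed

lemma finite_file_tuples: "finite (file_tuples C)"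
  unfolding file_tuples_def by (intro finite_PiE finite_words finite_files) simp

lemma file_tuples_nonempty: "file_tuples C \<noteq> {}"
proof -
  obtain x where "x \<in> file_alphabet C" using files_nonempty by auto
  then have "replicate (file_size C) x \<in> words (file_size C) (file_alphabet C)"
    by (auto simp: words_def)
  then show ?thesis
    unfolding file_tuples_def by (auto simp: PiE_eq_empty_iff)
qed

sublocale U: prob_space "uniform_count_measure (file_tuples C)"
  by (rule prob_space_uniform_count_measure[OF finite_file_tuples file_tuples_nonempty])

sublocale I: prob_space "uniform_count_measure {1..num_files C}"
  by (rule prob_space_uniform_count_measure) (use num_files_ge in auto)

sublocale SU: pair_prob_space "strategy C" "uniform_count_measure (file_tuples C)" ..

sublocale ISU: pair_prob_space "uniform_count_measure {1..num_files C}"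
  "strategy C \<Otimes>\<^sub>M uniform_count_measure (file_tuples C)" ..

sublocale P: information_space "ir_space C" 2
proof -
  interpret prob_space "ir_space C"
    unfolding ir_space_def by (rule ISU.prob_space_axioms)
  show "information_space (ir_space C) 2" by unfold_locales simp
qed

lemma space_ir_space:
  "space (ir_space C) = {1..num_files C} \<times> space (strategy C) \<times> file_tuples C"
  by (simp add: ir_space_def space_pair_measure space_uniform_count_measure)

lemma sets_box:
  assumes "J \<subseteq> {1..num_files C}" "E \<in> sets (strategy C)" "G \<subseteq> file_tuples C"
  shows "J \<times> E \<times> G \<in> sets (ir_space C)"
  unfolding ir_space_def
  using assms by (intro pair_measureI) (auto simp: sets_uniform_count_measure)

lemma prob_box:
  assumes "m \<in> {1..num_files C}" "E \<in> sets (strategy C)" "G \<subseteq> file_tuples C"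
  shows "P.prob ({m} \<times> E \<times> G) =
    S.prob E * (card G / card (file_tuples C)) / num_files C"
proof -
  have "P.prob ({m} \<times> E \<times> G) = I.prob {m} * SU.prob (E \<times> G)"
    unfolding ir_space_def
    by (subst measure_def, subst SU.P.emeasure_pair_measure_Times)
      (use assms in \<open>auto simp: sets_uniform_count_measure measure_def enn2real_mult\<close>)
  also have "SU.prob (E \<times> G) = S.prob E * U.prob G"
    by (subst measure_def, subst U.emeasure_pair_measure_Times)
      (use assms in \<open>auto simp: sets_uniform_count_measure measure_def enn2real_mult\<close>)
  also have "U.prob G = card G / card (file_tuples C)"
    using assms finite_file_tuples by (simp add: measure_uniform_count_measure)
  also have "I.prob {m} = 1 / num_files C"
    using assms by (simp add: measure_uniform_count_measure)
  finally show ?thesis by simp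
qed

text \<open>Index and strategy are independent, so conditioning on the index merely fixes the
  argument \<open>m\<close> of the query map. Both events are boxes, and the factor 1 /
  \<open>num_files C\<close> cancels.\<close>

lemma cond_prob_query:
  assumes l: "l \<in> {1..num_servers C}" and m: "m \<in> {1..num_files C}"
  shows "\<P>(\<omega> in ir_space C. query C l \<omega> = q \<bar> requested_index \<omega> = m) =
    S.prob {s \<in> space (strategy C). query_map C l m s = q}"
proof -
  have c: "card (file_tuples C) > 0"
    using finite_file_tuples file_tuples_nonempty by (simp add: card_gt_0_iff)
  have "{\<omega> \<in> space (ir_space C). query C l \<omega> = q \<and> requested_index \<omega> = m} =
      {m} \<times> {s \<in> space (strategy C). query_map C l m s = q} \<times> file_tuples C"
    using m by (auto simp: space_ir_space query_def requested_index_def)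
  moreover have "{\<omega> \<in> space (ir_space C). requested_index \<omega> = m} =
      {m} \<times> space (strategy C) \<times> file_tuples C"
    using m by (auto simp: space_ir_space requested_index_def)
  ultimately show ?thesis
    using num_files_ge c unfolding cond_prob_def
    by (simp add: prob_box[OF m sets_query[OF l m] subset_refl]
        prob_box[OF m sets.top subset_refl] S.prob_space)
qed

lemma integrable_query:
  fixes f :: "'q \<Rightarrow> real"
  assumes l: "l \<in> {1..num_servers C}" and m: "m \<in> {1..num_files C}"
  shows "integrable (strategy C) (\<lambda>s. f (query_map C l m s))"
proof (rule S.integrable_const_bound)
  show "AE s in strategy C. norm (f (query_map C l m s)) \<le> Max ((\<lambda>q. norm (f q)) ` query_alphabet C l)"
    using query_in_alphabet[OF l m] finite_queries[OF l] by (intro AE_I2 Max_ge) auto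
  show "(\<lambda>s. f (query_map C l m s)) \<in> borel_measurable (strategy C)"
    by (rule measurable_compose[OF measurable_query_map[OF l m]]) simp
qed

lemma expectation_query_map:
  fixes f :: "'q \<Rightarrow> real"
  assumes l: "l \<in> {1..num_servers C}" and m: "m \<in> {1..num_files C}"
  shows "(\<integral>s. f (query_map C l m s) \<partial>strategy C) =
    (\<Sum>q\<in>query_alphabet C l. S.prob {s \<in> space (strategy C). query_map C l m s = q} * f q)"
proof -
  let ?E = "\<lambda>q. {s \<in> space (strategy C). query_map C l m s = q}"
  have "(\<integral>s. f (query_map C l m s) \<partial>strategy C) =
      (\<integral>s. (\<Sum>q\<in>query_alphabet C l. indicator (?E q) s * f q) \<partial>strategy C)"
  proof (rule Bochner_Integration.integral_cong[OF refl])
    fix s assume s: "s \<in> space (strategy C)"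
    have "(\<Sum>q\<in>query_alphabet C l. indicator (?E q) s * f q) =
        (\<Sum>q\<in>query_alphabet C l. if q = query_map C l m s then f q else 0)"
      by (rule sum.cong) (use s in \<open>auto simp: indicator_def\<close>)
    then show "f (query_map C l m s) = (\<Sum>q\<in>query_alphabet C l. indicator (?E q) s * f q)"
      using query_in_alphabet[OF l m s] finite_queries[OF l] by simp
  qed
  also have "\<dots> = (\<Sum>q\<in>query_alphabet C l. \<integral>s. indicator (?E q) s * f q \<partial>strategy C)"
    by (rule Bochner_Integration.integral_sum)
      (auto intro!: integrable_mult_left integrable_real_indicator sets_query l m
        simp: S.emeasure_eq_measure)
  also have "\<dots> = (\<Sum>q\<in>query_alphabet C l. S.prob (?E q) * f q)"
  proof (rule sum.cong[OF refl])
    fix q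
    have "?E q \<inter> space (strategy C) = ?E q" by auto
    then show "(\<integral>s. indicator (?E q) s * f q \<partial>strategy C) = S.prob (?E q) * f q"
      by (simp add: Bochner_Integration.integral_indicator)
  qed
  finally show ?thesis .
qed

text \<open>By Fubini, the uniform index gives the average over \<open>m\<close>, and the files
  integrate out to 1.\<close>

lemma expectation_query:
  fixes f :: "'q \<Rightarrow> real"
  assumes l: "l \<in> {1..num_servers C}"
  shows "(\<integral>\<omega>. f (query C l \<omega>) \<partial>ir_space C) =
    (\<Sum>m\<in>{1..num_files C}. \<integral>s. f (query_map C l m s) \<partial>strategy C) / num_files C"
proof -
  let ?U = "uniform_count_measure (file_tuples C)"
  let ?I = "uniform_count_measure {1..num_files C}"
  let ?g = "\<lambda>m z. f (query_map C l m (fst z))"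
  have meas: "?g m \<in> borel_measurable (strategy C \<Otimes>\<^sub>M ?U)" if "m \<in> {1..num_files C}" for m
  proof -
    have "(\<lambda>z. query_map C l m (fst z)) \<in>
        (strategy C \<Otimes>\<^sub>M ?U) \<rightarrow>\<^sub>M count_space (query_alphabet C l)"
      by (rule measurable_compose[OF measurable_fst measurable_query_map[OF l that]])
    then show ?thesis by (rule measurable_compose) simp
  qed
  have "case_prod ?g \<in> borel_measurable (count_space {1..num_files C} \<Otimes>\<^sub>M (strategy C \<Otimes>\<^sub>M ?U))"
    by (rule measurable_pair_measure_countable1) (use meas in auto)
  \<comment> \<open>Joint measurability rests on the countable index set and is stated for
    \<open>count_space\<close>, which has the same measurable sets as the uniform measure.\<close>
  moreover have ss: "sets (count_space {1..num_files C} \<Otimes>\<^sub>M (strategy C \<Otimes>\<^sub>M ?U)) = sets (?I \<Otimes>\<^sub>M (strategy C \<Otimes>\<^sub>M ?U))"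
    by (intro sets_pair_measure_cong) (auto simp: sets_uniform_count_measure)
  ultimately have M: "case_prod ?g \<in> borel_measurable (?I \<Otimes>\<^sub>M (strategy C \<Otimes>\<^sub>M ?U))"
    by (simp only: measurable_cong_sets[OF ss refl])
  have bound: "norm (case_prod ?g z) \<le> Max ((\<lambda>q. norm (f q)) ` query_alphabet C l)"
    if "z \<in> space (ir_space C)" for z
    using that query_in_alphabet[OF l] finite_queries[OF l]
    by (auto simp: space_ir_space intro!: Max_ge)
  have int: "integrable (?I \<Otimes>\<^sub>M (strategy C \<Otimes>\<^sub>M ?U)) (case_prod ?g)"
    by (rule ISU.P.integrable_const_bound[OF AE_I2 M]) (use bound in \<open>auto simp: ir_space_def\<close>)
  have "(\<integral>\<omega>. f (query C l \<omega>) \<partial>ir_space C) = (\<integral>\<omega>. case_prod ?g \<omega> \<partial>ir_space C)"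
    by (simp add: query_def split_beta')
  also have "\<dots> = (\<integral>m. \<integral>z. ?g m z \<partial>(strategy C \<Otimes>\<^sub>M ?U) \<partial>?I)"
    unfolding ir_space_def using ISU.integral_fst'[OF int] by simp
  also have "\<dots> = (\<Sum>m\<in>{1..num_files C}. \<integral>z. ?g m z \<partial>(strategy C \<Otimes>\<^sub>M ?U)) / num_files C"
    by (simp add: integral_uniform_count_measure)
  also have "(\<Sum>m\<in>{1..num_files C}. \<integral>z. ?g m z \<partial>(strategy C \<Otimes>\<^sub>M ?U)) =
      (\<Sum>m\<in>{1..num_files C}. \<integral>s. f (query_map C l m s) \<partial>strategy C)"
  proof (rule sum.cong[OF refl])
    fix m assume m: "m \<in> {1..num_files C}"
    have "integrable (strategy C \<Otimes>\<^sub>M ?U) (?g m)"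
      by (rule SU.P.integrable_const_bound[OF AE_I2 meas[OF m],
            of "Max ((\<lambda>q. norm (f q)) ` query_alphabet C l)"])
         (use query_in_alphabet[OF l m] finite_queries[OF l] in
           \<open>auto simp: space_pair_measure intro!: Max_ge\<close>)
    from SU.integral_fst'[OF this] show
      "(\<integral>z. ?g m z \<partial>(strategy C \<Otimes>\<^sub>M ?U)) = (\<integral>s. f (query_map C l m s) \<partial>strategy C)"
      by (simp add: U.prob_space)
  qed
  finally show ?thesis .
qed

text \<open>The queries to all servers as one value, restricted to the server indices so that it is
  literally the second component of \<open>retrieved C\<close>.\<close>

definition queries :: "nat \<Rightarrow> 's \<Rightarrow> nat \<Rightarrow> 'q" where
  "queries m s = (\<lambda>l\<in>{1..num_servers C}. query_map C l m s)"

lemma sets_queries: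
  assumes m: "m \<in> {1..num_files C}"
  shows "{s \<in> space (strategy C). queries m s = k} \<in> sets (strategy C)"
proof (cases "k \<in> extensional {1..num_servers C}")
  case True
  then have "{s \<in> space (strategy C). queries m s = k} =
      {s \<in> space (strategy C). \<forall>l\<in>{1..num_servers C}. query_map C l m s = k l}"
    by (auto simp: queries_def fun_eq_iff extensional_def)
  also have "\<dots> \<in> sets (strategy C)"
    by (intro sets.sets_Collect_finite_All sets_query m) auto
  finally show ?thesis .
next
  case False
  then have "{s \<in> space (strategy C). queries m s = k} = {}"
    by (auto simp: queries_def)
  then show ?thesis by (simp only: sets.empty_sets)
qed

text \<open>The strategy space is arbitrary, yet \<open>requested_file\<close> and
  \<open>retrieved C\<close> depend on the strategy through the query vector at most. They factor
  through this map, which has finitely many values.\<close>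

lemma simple_function_view:
  "simple_function (ir_space C) (\<lambda>(m, s, F). (m, queries m s, F))" (is "simple_function _ ?T")
  unfolding simple_function_def
proof
  have "?T ` space (ir_space C) \<subseteq>
      {1..num_files C} \<times> (\<Pi>\<^sub>E l\<in>{1..num_servers C}. query_alphabet C l) \<times> file_tuples C"
    using query_in_alphabet by (fastforce simp: space_ir_space queries_def)
  moreover have "finite \<dots>"
    by (intro finite_cartesian_product finite_PiE finite_file_tuples finite_queries) auto
  ultimately show "finite (?T ` space (ir_space C))" by (rule finite_subset)
  show "\<forall>z\<in>?T ` space (ir_space C). ?T -` {z} \<inter> space (ir_space C) \<in> sets (ir_space C)"
  proof
    fix z assume "z \<in> ?T ` space (ir_space C)"
    then obtain m k F where z: "z = (m, k, F)" "m \<in> {1..num_files C}" "F \<in> file_tuples C"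
      by (auto simp: space_ir_space)
    then have "?T -` {z} \<inter> space (ir_space C) =
        {m} \<times> {s \<in> space (strategy C). queries m s = k} \<times> {F}"
      by (auto simp: space_ir_space)
    then show "?T -` {z} \<inter> space (ir_space C) \<in> sets (ir_space C)"
      using sets_box[of "{m}" "{s \<in> space (strategy C). queries m s = k}" "{F}"] z sets_queries
      by simp
  qed
qed

lemma simple_function_requested_file: "simple_function (ir_space C) requested_file"
proof -
  have eq: "requested_file = (\<lambda>(m, k, F). F m) \<circ> (\<lambda>(m, s, F). (m, queries m s, F))"
    by (auto simp: requested_file_def)
  show ?thesis unfolding eq by (rule simple_function_compose[OF simple_function_view])
qed

lemma retrieved_eq:
  "retrieved C (m, s, F) =
    (\<lambda>l\<in>{1..num_servers C}. answer_map C l (query_map C l m s) F, queries m s, m)"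
  by (simp add: retrieved_def queries_def answer_def query_def requested_index_def)

lemma simple_function_retrieved: "simple_function (ir_space C) (retrieved C)"
proof -
  have eq: "retrieved C = (\<lambda>(m, k, F). (\<lambda>l\<in>{1..num_servers C}. answer_map C l (k l) F, k, m))
      \<circ> (\<lambda>(m, s, F). (m, queries m s, F))"
    by (auto simp: retrieved_eq queries_def fun_eq_iff)
  show ?thesis unfolding eq by (rule simple_function_compose[OF simple_function_view])
qed

lemma cond_entropy_eq_0_iff:
  "cond_entropy (ir_space C) requested_file (retrieved C) = 0 \<longleftrightarrow>
    (\<forall>\<omega>\<in>space (ir_space C).
       P.prob {\<eta>\<in>space (ir_space C). requested_file \<eta> = requested_file \<omega> \<and> retrieved C \<eta> = retrieved C \<omega>} = 0 \<or>
       P.prob {\<eta>\<in>space (ir_space C). requested_file \<eta> = requested_file \<omega> \<and> retrieved C \<eta> = retrieved C \<omega>} =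
       P.prob {\<eta>\<in>space (ir_space C). retrieved C \<eta> = retrieved C \<omega>})"
  unfolding cond_entropy_def
  by (rule P.conditional_entropy_eq_0_iff[OF simple_function_requested_file simple_function_retrieved])

text \<open>The form needed for achievability. Strategies with equal queries yield equal answers, so
  the retrieved data determine the requested file, and the last two events in the criterion
  coincide.\<close>

lemma cond_entropy_eq_0I:
  assumes dec: "\<And>m s F F'. \<lbrakk>m \<in> {1..num_files C}; s \<in> space (strategy C); F \<in> file_tuples C; F' \<in> file_tuples C;
      \<And>l. l \<in> {1..num_servers C} \<Longrightarrow>
        answer_map C l (query_map C l m s) F = answer_map C l (query_map C l m s) F'\<rbrakk>
      \<Longrightarrow> F m = F' m"
  shows "cond_entropy (ir_space C) requested_file (retrieved C) = 0"
  unfolding cond_entropy_eq_0_iff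
proof (intro ballI disjI2 arg_cong[where f = P.prob])
  fix \<omega> assume \<omega>: "\<omega> \<in> space (ir_space C)"
  have "requested_file \<eta> = requested_file \<omega>"
    if \<eta>: "\<eta> \<in> space (ir_space C)" and eq: "retrieved C \<eta> = retrieved C \<omega>" for \<eta>
  proof -
    obtain m s F where w: "\<omega> = (m, s, F)" by (cases \<omega>)
    obtain m' s' F' where e: "\<eta> = (m', s', F')" by (cases \<eta>)
    have mm: "m' = m" and qq: "queries m s' = queries m s"
      and aa: "(\<lambda>l\<in>{1..num_servers C}. answer_map C l (query_map C l m s') F') =
        (\<lambda>l\<in>{1..num_servers C}. answer_map C l (query_map C l m s) F)"
      using eq by (auto simp: w e retrieved_eq)
    have "query_map C l m s' = query_map C l m s" if "l \<in> {1..num_servers C}" for l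
      using fun_cong[OF qq, of l] that by (simp add: queries_def)
    then have "answer_map C l (query_map C l m s) F' = answer_map C l (query_map C l m s) F"
      if "l \<in> {1..num_servers C}" for l
      using fun_cong[OF aa, of l] that by simp
    then show ?thesis
      using dec[of m s F' F] \<omega> \<eta> by (simp add: w e mm space_ir_space requested_file_def)
  qed
  then show "{\<eta>\<in>space (ir_space C). requested_file \<eta> = requested_file \<omega> \<and> retrieved C \<eta> = retrieved C \<omega>} =
      {\<eta>\<in>space (ir_space C). retrieved C \<eta> = retrieved C \<omega>}"
    by auto
qed

lemma sets_retrieved:
  "{\<eta>\<in>space (ir_space C). Q \<eta> \<and> retrieved C \<eta> = y} \<in> sets (ir_space C)"
  if "{\<eta>\<in>space (ir_space C). Q \<eta>} \<in> sets (ir_space C)"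
proof -
  have "retrieved C -` {y} \<inter> space (ir_space C) \<in> sets (ir_space C)"
    using simple_function_retrieved by (rule simple_functionD)
  from sets.Int[OF that this] show ?thesis
    by (rule back_subst[where P = "\<lambda>A. A \<in> sets (ir_space C)"]) auto
qed

text \<open>Zero entropy says nothing about events of probability zero, hence the assumption on the
  query vector. If \<open>F m\<close> and \<open>F' m\<close> differed, two disjoint events of
  positive probability would lie in the event of one retrieved value, although one of them already
  has its full probability.\<close>

lemma decodable:
  assumes ent: "cond_entropy (ir_space C) requested_file (retrieved C) = 0"
    and m: "m \<in> {1..num_files C}" and s: "s \<in> space (strategy C)"
    and F: "F \<in> file_tuples C" and F': "F' \<in> file_tuples C"
    and pos: "S.prob {s' \<in> space (strategy C). queries m s' = queries m s} > 0"
    and ans: "\<And>l. l \<in> {1..num_servers C} \<Longrightarrow>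
        answer_map C l (query_map C l m s) F = answer_map C l (query_map C l m s) F'"
  shows "F m = F' m"
proof (rule ccontr)
  assume ne: "F m \<noteq> F' m"
  let ?E = "{s' \<in> space (strategy C). queries m s' = queries m s}"
  let ?y = "retrieved C (m, s, F)"
  let ?B = "\<lambda>G. {\<eta>\<in>space (ir_space C). requested_file \<eta> = G m \<and> retrieved C \<eta> = ?y}"
  let ?Y = "{\<eta>\<in>space (ir_space C). retrieved C \<eta> = ?y}"
  \<comment> \<open>All strategies with the given query vector produce the same retrieved value, so
    a whole box of positive probability lies in the event.\<close>
  have sub: "{m} \<times> ?E \<times> {G} \<subseteq> ?B G" if "G = F \<or> G = F'" for G
  proof -
    have "retrieved C (m, s', G) = ?y" if "queries m s' = queries m s" for s'
    proof -
      have "query_map C l m s' = query_map C l m s" if "l \<in> {1..num_servers C}" for l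
        using fun_cong[OF \<open>queries m s' = queries m s\<close>, of l] that by (simp add: queries_def)
      then show ?thesis
        using that ans \<open>G = F \<or> G = F'\<close> by (auto simp: retrieved_eq)
    qed
    then show ?thesis
      using that m F F' by (auto simp: space_ir_space requested_file_def)
  qed
  have setsB: "?B G \<in> sets (ir_space C)" for G
  proof (rule sets_retrieved)
    have "requested_file -` {G m} \<inter> space (ir_space C) \<in> sets (ir_space C)"
      using simple_function_requested_file by (rule simple_functionD)
    then show "{\<eta> \<in> space (ir_space C). requested_file \<eta> = G m} \<in> sets (ir_space C)"
      by (rule back_subst[where P = "\<lambda>A. A \<in> sets (ir_space C)"]) auto
  qed
  have posB: "P.prob (?B G) > 0" if "G = F \<or> G = F'" for G
  proof -
    have "card (file_tuples C) > 0"
      using finite_file_tuples file_tuples_nonempty by (simp add: card_gt_0_iff)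
    then have "0 < P.prob ({m} \<times> ?E \<times> {G})"
      using that F F' pos num_files_ge by (subst prob_box[OF m sets_queries[OF m]]) auto
    also have "\<dots> \<le> P.prob (?B G)"
      by (rule P.finite_measure_mono[OF sub[OF that] setsB[of G]])
    finally show ?thesis .
  qed
  have "(m, s, F) \<in> space (ir_space C)" using m s F by (simp add: space_ir_space)
  then have full: "P.prob (?B F) = P.prob ?Y"
    using ent posB[of F] unfolding cond_entropy_eq_0_iff by (force simp: requested_file_def)
  have "P.prob (?B F) + P.prob (?B F') = P.prob (?B F \<union> ?B F')"
    by (rule P.finite_measure_Union[symmetric]) (use ne setsB in auto)
  also have "\<dots> \<le> P.prob ?Y"
    by (rule P.finite_measure_mono) (use sets_retrieved[of "\<lambda>_. True" ?y] in auto)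
  finally show False using full posB[of F'] by simp
qed

end

subsection \<open>Converse\<close>

text \<open>With \<open>x\<close> the value of a file held fixed and \<open>y\<close> ranging over
  the values of the other one, this is the average over \<open>x\<close> of the Hartley entropy of
  \<open>f x y\<close>.\<close>

definition avg_log_range :: "'w set \<Rightarrow> ('w \<Rightarrow> 'w \<Rightarrow> 'b) \<Rightarrow> real" where
  "avg_log_range W f = (\<Sum>x\<in>W. log 2 (card (f x ` W))) / card W"

lemma card_image_pos:
  "finite W \<Longrightarrow> W \<noteq> {} \<Longrightarrow> 0 < card (f ` W)"
  by (simp add: card_gt_0_iff)

lemma avg_log_range_nonneg:
  assumes "finite W" "W \<noteq> {}"
  shows "0 \<le> avg_log_range W f"
proof -
  have "0 \<le> log 2 (card (f x ` W))" for x
    using card_image_pos[OF assms, of "f x"] by simp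
  then show ?thesis unfolding avg_log_range_def by (intro divide_nonneg_nonneg sum_nonneg) auto
qed

lemma avg_log_range_le:
  assumes "finite W" "W \<noteq> {}" and k: "\<And>x. x \<in> W \<Longrightarrow> card (f x ` W) \<le> k"
  shows "avg_log_range W f \<le> log 2 k"
proof -
  have "(\<Sum>x\<in>W. log 2 (card (f x ` W))) \<le> (\<Sum>x\<in>W. log 2 k)"
  proof (rule sum_mono)
    fix x assume "x \<in> W"
    then show "log 2 (card (f x ` W)) \<le> log 2 k"
      using k card_image_pos[OF assms(1,2), of "f x"] by (intro log_mono) auto
  qed
  moreover have "0 < card W" using assms by (simp add: card_gt_0_iff)
  ultimately show ?thesis unfolding avg_log_range_def by (simp add: field_simps)
qed

text \<open>The pair of answers determines \<open>x\<close>, so the sets of pairs for different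
  \<open>x\<close> are disjoint and their sizes add up to at most |A| |B|. Each is at least as large
  as the range of \<open>f x\<close>, and Jensen's inequality passes from the mean of the range
  sizes to the mean of their logarithms.\<close>

lemma avg_log_range_decode_fst:
  assumes W: "finite W" "W \<noteq> {}" and AB: "finite A" "finite B"
    and f: "\<And>x y. x \<in> W \<Longrightarrow> y \<in> W \<Longrightarrow> f x y \<in> A"
    and g: "\<And>x y. x \<in> W \<Longrightarrow> y \<in> W \<Longrightarrow> g x y \<in> B"
    and dec: "\<And>x y x' y'. \<lbrakk>x \<in> W; y \<in> W; x' \<in> W; y' \<in> W; f x y = f x' y'; g x y = g x' y'\<rbrakk> \<Longrightarrow> x = x'"
  shows "log 2 (card W) + avg_log_range W f \<le> log 2 (card A) + log 2 (card B)"
proof -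
  have N: "0 < card W" using W by (simp add: card_gt_0_iff)
  let ?r = "\<lambda>x. card (f x ` W)"
  let ?fg = "\<lambda>x. (\<lambda>y. (f x y, g x y)) ` W"
  have "(\<Sum>x\<in>W. ?r x) \<le> (\<Sum>x\<in>W. card (?fg x))"
  proof (rule sum_mono)
    fix x
    have "f x ` W = fst ` ?fg x" by force
    then show "?r x \<le> card (?fg x)" using W by (metis card_image_le finite_imageI)
  qed
  also have "\<dots> = card (\<Union>x\<in>W. ?fg x)"
  proof (rule card_UN_disjoint[symmetric])
    show "\<forall>x\<in>W. \<forall>x'\<in>W. x \<noteq> x' \<longrightarrow> ?fg x \<inter> ?fg x' = {}"
    proof (intro ballI impI equals0I)
      fix x x' z assume x: "x \<in> W" "x' \<in> W" "x \<noteq> x'" and "z \<in> ?fg x \<inter> ?fg x'"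
      then obtain y y' where "y \<in> W" "y' \<in> W" "f x y = f x' y'" "g x y = g x' y'" by auto
      with x dec[of x y x' y'] show False by simp
    qed
  qed (use W in auto)
  also have "\<dots> \<le> card (A \<times> B)"
    by (rule card_mono) (use f g AB in auto)
  finally have le: "(\<Sum>x\<in>W. real (?r x)) \<le> real (card A * card B)"
    by (metis card_cartesian_product of_nat_le_iff of_nat_sum)
  have pos: "0 < (\<Sum>x\<in>W. real (?r x))"
    using W card_image_pos[OF W] by (intro sum_pos) auto
  have "(\<Sum>x\<in>W. (1 / card W) * log 2 (?r x)) \<le> log 2 (\<Sum>x\<in>W. (1 / card W) *\<^sub>R real (?r x))"
    by (rule concave_on_sum[OF W log_concave[of 2]]) (use N card_image_pos[OF W] in auto)
  then have "avg_log_range W f \<le> log 2 ((\<Sum>x\<in>W. real (?r x)) / card W)"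
    unfolding avg_log_range_def by (simp add: sum_divide_distrib)
  also have "\<dots> = log 2 (\<Sum>x\<in>W. real (?r x)) - log 2 (card W)"
    using pos N by (simp add: log_divide)
  also have "log 2 (\<Sum>x\<in>W. real (?r x)) \<le> log 2 (card A * card B)"
    using pos le by simp
  also have "log 2 (card A * card B) = log 2 (card A) + log 2 (card B)"
  proof -
    have "0 < real (card A * card B)" using pos le by linarith
    then have "0 < card A" "0 < card B" by (auto simp: zero_less_mult_iff)
    then show ?thesis by (simp add: log_mult)
  qed
  finally show ?thesis by simp
qed

text \<open>For each fixed \<open>x\<close> the pair of answers is injective in \<open>y\<close>, so
  the product of the two ranges has at least \<open>card W\<close> elements. Logarithms are then
  averaged over \<open>x\<close>.\<close>

lemma avg_log_range_decode_snd:
  assumes W: "finite W" "W \<noteq> {}"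
    and dec: "\<And>x y y'. \<lbrakk>x \<in> W; y \<in> W; y' \<in> W; f x y = f x y'; g x y = g x y'\<rbrakk> \<Longrightarrow> y = y'"
  shows "log 2 (card W) \<le> avg_log_range W f + avg_log_range W g"
proof -
  have N: "0 < card W" using W by (simp add: card_gt_0_iff)
  have "log 2 (card W) \<le> log 2 (card (f x ` W)) + log 2 (card (g x ` W))" if x: "x \<in> W" for x
  proof -
    have "card W = card ((\<lambda>y. (f x y, g x y)) ` W)"
      by (rule card_image[symmetric]) (use dec x in \<open>auto simp: inj_on_def\<close>)
    also have "\<dots> \<le> card ((f x ` W) \<times> (g x ` W))"
      by (rule card_mono) (use W in auto)
    also have "\<dots> = card (f x ` W) * card (g x ` W)" by (rule card_cartesian_product)
    finally have "log 2 (card W) \<le> log 2 (real (card (f x ` W)) * real (card (g x ` W)))"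
      using N by (intro log_mono) (simp_all flip: of_nat_mult)
    then show ?thesis using card_image_pos[OF W, of "f x"] card_image_pos[OF W, of "g x"]
      by (simp add: log_mult)
  qed
  then have "(\<Sum>x\<in>W. log 2 (card W)) \<le> (\<Sum>x\<in>W. log 2 (card (f x ` W)) + log 2 (card (g x ` W)))"
    by (rule sum_mono)
  then show ?thesis
    using N unfolding avg_log_range_def by (simp add: sum.distrib field_simps)
qed

section \<open>Query probabilities\<close>

context query_scheme
begin

definition query_prob :: "nat \<Rightarrow> nat \<Rightarrow> 'q \<Rightarrow> real" where
  "query_prob l m q = S.prob {s \<in> space (strategy C). query_map C l m s = q}"

lemma sum_query_prob:
  assumes "l \<in> {1..num_servers C}" "m \<in> {1..num_files C}"
  shows "(\<Sum>q\<in>query_alphabet C l. query_prob l m q) = 1"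
  using expectation_query_map[OF assms, of "\<lambda>_. 1"] by (simp add: query_prob_def S.prob_space)

text \<open>There are finitely many query vectors, so those of probability zero together form a null
  event. This makes \<open>decodable\<close> available for almost every strategy.\<close>

lemma AE_queries_pos:
  assumes m: "m \<in> {1..num_files C}"
  shows "AE s in strategy C. 0 < S.prob {s' \<in> space (strategy C). queries m s' = queries m s}"
proof -
  let ?E = "\<lambda>k. {s \<in> space (strategy C). queries m s = k}"
  let ?K = "\<Pi>\<^sub>E l\<in>{1..num_servers C}. query_alphabet C l"
  have "AE s in strategy C. \<forall>k\<in>{k\<in>?K. S.prob (?E k) = 0}. s \<notin> ?E k"
  proof (rule AE_finite_allI)
    show "finite {k\<in>?K. S.prob (?E k) = 0}"
      by (intro finite_Collect_conjI disjI1) (unfold Collect_mem_eq, intro finite_PiE finite_queries; simp)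
    fix k assume "k \<in> {k\<in>?K. S.prob (?E k) = 0}"
    then have "?E k \<in> null_sets (strategy C)"
      using sets_queries[OF m] by (auto simp: null_sets_def S.emeasure_eq_measure)
    then show "AE s in strategy C. s \<notin> ?E k" by (rule AE_not_in)
  qed
  then show ?thesis
  proof (rule AE_mp, intro AE_I2 impI)
    fix s assume s: "s \<in> space (strategy C)"
      and *: "\<forall>k\<in>{k\<in>?K. S.prob (?E k) = 0}. s \<notin> ?E k"
    have "queries m s \<in> ?K"
      using query_in_alphabet[OF _ m s] by (auto simp: queries_def)
    then have "S.prob (?E (queries m s)) \<noteq> 0" using * s by auto
    then show "0 < S.prob (?E (queries m s))" by (simp add: zero_less_measure_iff)
  qed
qed

end

section \<open>Leakage and download cost for two files and two servers\<close>

locale scheme_2_2 = query_scheme C for C :: "('s, 'q, 'x, 'a) ir_scheme" +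
  assumes two_files: "num_files C = 2" and two_servers: "num_servers C = 2"
begin

text \<open>The \<open>K l\<close> of the overview. It exceeds 1 by the total variation distance of
  the two query laws at server \<open>l\<close>.\<close>

definition max_prob_sum :: "nat \<Rightarrow> real" where
  "max_prob_sum l = (\<Sum>q\<in>query_alphabet C l. max (query_prob l 1 q) (query_prob l 2 q))"

lemma leakage_eq:
  assumes "l \<in> {1, 2}"
  shows "leakage C l = log 2 (max_prob_sum l)"
proof -
  have eq: "{1..num_files C} = {1, 2}" unfolding two_files by auto
  then have m: "1 \<in> {1..num_files C}" "2 \<in> {1..num_files C}" by auto
  have l: "l \<in> {1..num_servers C}" using assms by (auto simp: two_servers)
  have "Max ((\<lambda>m. \<P>(\<omega> in ir_space C. query C l \<omega> = q \<bar> requested_index \<omega> = m)) ` {1..num_files C})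
      = max (query_prob l 1 q) (query_prob l 2 q)" for q
    unfolding eq by (simp only: image_insert image_empty cond_prob_query[OF l m(1)]
        cond_prob_query[OF l m(2)] query_prob_def) simp
  then show ?thesis by (simp add: leakage_def max_prob_sum_def)
qed

lemma max_prob_sum_ge: "l \<in> {1, 2} \<Longrightarrow> 1 \<le> max_prob_sum l"
proof -
  assume "l \<in> {1, 2}"
  then have "1 = (\<Sum>q\<in>query_alphabet C l. query_prob l 1 q)"
    by (intro sum_query_prob[symmetric]) (auto simp: two_files two_servers)
  also have "\<dots> \<le> max_prob_sum l"
    unfolding max_prob_sum_def by (rule sum_mono) simp
  finally show ?thesis .
qed

lemma powr_leakage: "l \<in> {1, 2} \<Longrightarrow> 2 powr leakage C l = max_prob_sum l"
  using max_prob_sum_ge[of l] by (simp add: leakage_eq)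

text \<open>The expectations of a function with values in [0, c] under two laws differ by at most c
  times their total variation distance.\<close>

lemma expectation_diff_le:
  assumes l: "l \<in> {1, 2}" and m: "m \<in> {1, 2}" "m' \<in> {1, 2}"
    and f: "\<And>q. q \<in> query_alphabet C l \<Longrightarrow> 0 \<le> f q" "\<And>q. q \<in> query_alphabet C l \<Longrightarrow> f q \<le> c"
    and c: "0 \<le> c"
  shows "(\<integral>s. f (query_map C l m s) \<partial>strategy C) - (\<integral>s. f (query_map C l m' s) \<partial>strategy C)
    \<le> c * (max_prob_sum l - 1)"
proof -
  have l': "l \<in> {1..num_servers C}" and m': "m \<in> {1..num_files C}" "m' \<in> {1..num_files C}"
    using l m by (auto simp: two_servers two_files)
  let ?M = "\<lambda>q. max (query_prob l 1 q) (query_prob l 2 q)"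
  have "(\<integral>s. f (query_map C l m s) \<partial>strategy C) - (\<integral>s. f (query_map C l m' s) \<partial>strategy C) =
      (\<Sum>q\<in>query_alphabet C l. (query_prob l m q - query_prob l m' q) * f q)"
    by (simp add: expectation_query_map[OF l' m'(1)] expectation_query_map[OF l' m'(2)]
        query_prob_def sum_subtractf left_diff_distrib)
  \<comment> \<open>Raising the first probability to the maximum makes the coefficient nonnegative,
    after which \<open>f q\<close> may be replaced by \<open>c\<close>.\<close>
  also have "\<dots> \<le> (\<Sum>q\<in>query_alphabet C l. (?M q - query_prob l m' q) * c)"
  proof (rule sum_mono)
    fix q assume q: "q \<in> query_alphabet C l"
    have "(query_prob l m q - query_prob l m' q) * f q \<le> (?M q - query_prob l m' q) * f q"
      using f(1)[OF q] m by (intro mult_right_mono) auto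
    also have "\<dots> \<le> (?M q - query_prob l m' q) * c"
      using f(2)[OF q] m by (intro mult_left_mono) auto
    finally show "(query_prob l m q - query_prob l m' q) * f q \<le> (?M q - query_prob l m' q) * c" .
  qed
  also have "\<dots> = (max_prob_sum l - 1) * c"
    by (simp add: max_prob_sum_def sum_distrib_right[symmetric] sum_subtractf sum_query_prob[OF l' m'(2)])
  finally show ?thesis by (simp add: mult.commute)
qed

text \<open>The index \<open>m\<close> selects the file that is held fixed, so that one argument
  serves both requests. The restriction puts the tuple into the extensional product
  \<open>file_tuples C\<close>.\<close>

definition place_files :: "nat \<Rightarrow> 'x list \<Rightarrow> 'x list \<Rightarrow> nat \<Rightarrow> 'x list" where
  "place_files m x y = (\<lambda>i\<in>{1..2}. if i = m then x else y)"

lemma place_files_in: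
  "x \<in> words (file_size C) (file_alphabet C) \<Longrightarrow> y \<in> words (file_size C) (file_alphabet C) \<Longrightarrow>
    place_files m x y \<in> file_tuples C"
  by (simp add: place_files_def file_tuples_def two_files)

lemma download_cost_eq:
  "download_cost C = (\<Sum>m\<in>{1, 2}.
     \<integral>s. log 2 (card (answer_symbols C)) * answer_length C 1 (query_map C 1 m s) \<partial>strategy C) / 2
   + (\<Sum>m\<in>{1, 2}.
     \<integral>s. log 2 (card (answer_symbols C)) * answer_length C 2 (query_map C 2 m s) \<partial>strategy C) / 2"
proof -
  have two: "{1..2::nat} = {1, 2}" by auto
  have e: "(\<integral>\<omega>. answer_length C l (query C l \<omega>) \<partial>ir_space C) =
      ((\<integral>s. answer_length C l (query_map C l 1 s) \<partial>strategy C) +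
       (\<integral>s. answer_length C l (query_map C l 2 s) \<partial>strategy C)) / 2" if "l \<in> {1, 2}" for l
    using expectation_query[of l "\<lambda>q. real (answer_length C l q)"] that
    unfolding two_servers two_files two by simp
  show ?thesis
    unfolding download_cost_def two_servers two
    using e[of 1] e[of 2] by (simp add: distrib_left add_divide_distrib)
qed

end

text \<open>The size condition is imposed per query because in this form it follows whether or not
  \<open>[]\<close> counts as an answer. The first bound holds at any leakage; the second is the one
  of the overview.\<close>

lemma (in scheme_2_2) download_cost_ge:
  assumes card_files: "2 \<le> card (file_alphabet C)"
    and symbols: "finite (answer_symbols C)" "answer_symbols C \<noteq> {}"
    and answers: "\<And>l q F. l \<in> {1, 2} \<Longrightarrow> q \<in> query_alphabet C l \<Longrightarrow> F \<in> file_tuples C \<Longrightarrow>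
        answer_map C l q F \<in> words (answer_length C l q) (answer_symbols C)"
    and small: "\<And>l q. l \<in> {1, 2} \<Longrightarrow> q \<in> query_alphabet C l \<Longrightarrow>
        card (answer_symbols C) ^ answer_length C l q \<le> card (file_alphabet C) ^ file_size C"
    and ent: "cond_entropy (ir_space C) requested_file (retrieved C) = 0"
  shows "file_size C * log 2 (card (file_alphabet C)) \<le> download_cost C"
    and "file_size C * log 2 (card (file_alphabet C)) *
        (5 / 2 - (2 powr leakage C 1 + 2 powr leakage C 2) / 2) \<le> download_cost C"
proof -
  define W where "W = words (file_size C) (file_alphabet C)"
  define L where "L = file_size C * log 2 (card (file_alphabet C))"
  define a where "a = log 2 (card (answer_symbols C))"
  \<comment> \<open>File \<open>m\<close> is the one held fixed; the query \<open>q\<close> may come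
    from either request.\<close>
  define h where "h m l q = avg_log_range W (\<lambda>x y. answer_map C l q (place_files m x y))" for m l q
  define E where "E l m f = (\<integral>s. f (query_map C l m s) \<partial>strategy C)" for l m and f :: "'q \<Rightarrow> real"
  define D where "D m = E 1 m (\<lambda>q. a * answer_length C 1 q) + E 2 m (\<lambda>q. a * answer_length C 2 q)" for m
  have W: "finite W" "W \<noteq> {}"
  proof -
    show "finite W" unfolding W_def by (rule finite_words[OF finite_files])
    obtain x where "x \<in> file_alphabet C" using files_nonempty by auto
    then have "replicate (file_size C) x \<in> W" by (auto simp: W_def words_def)
    then show "W \<noteq> {}" by auto
  qed
  have L: "log 2 (card W) = L"
    using card_files by (simp add: W_def card_words[OF finite_files] L_def log_nat_power)
  have L0: "0 \<le> L" using card_files by (simp add: L_def)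
  have servers: "l \<in> {1..num_servers C} \<longleftrightarrow> l \<in> {1, 2}" for l by (auto simp: two_servers)
  have files: "m \<in> {1..num_files C} \<longleftrightarrow> m \<in> {1, 2}" for m by (auto simp: two_files)
  have place: "place_files m x y \<in> file_tuples C" if "x \<in> W" "y \<in> W" for m x y
    using that place_files_in by (simp add: W_def)
  have place_m: "place_files m x y m = x" "place_files m x y (3 - m) = y"
    if "m \<in> {1, 2}" for m x y
    using that by (auto simp: place_files_def)
  have symb: "0 < card (answer_symbols C)" using symbols by (simp add: card_gt_0_iff)
  have log_words: "log 2 (card (words (answer_length C l q) (answer_symbols C))) = a * answer_length C l q"
    for l q using symb by (simp add: card_words[OF symbols(1)] a_def log_nat_power)
  have h0: "0 \<le> h m l q" for m l q unfolding h_def by (rule avg_log_range_nonneg[OF W])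
  \<comment> \<open>This is where the size of the answers matters: it keeps \<open>h\<close> in
    [0, L], so that \<open>L\<close> can serve as the constant \<open>c\<close> of
    \<open>expectation_diff_le\<close>.\<close>
  have hL: "h m l q \<le> L" if lq: "l \<in> {1, 2}" "q \<in> query_alphabet C l" for m l q
  proof -
    have "h m l q \<le> log 2 (card W)"
      unfolding h_def
    proof (rule avg_log_range_le[OF W])
      fix x assume x: "x \<in> W"
      have "card ((\<lambda>y. answer_map C l q (place_files m x y)) ` W) \<le>
          card (words (answer_length C l q) (answer_symbols C))"
        by (rule card_mono) (use finite_words[OF symbols(1)] answers[OF lq place[OF x]] in auto)
      also have "\<dots> \<le> card W"
        using small[OF lq] by (simp add: card_words[OF symbols(1)] W_def card_words[OF finite_files])
      finally show "card ((\<lambda>y. answer_map C l q (place_files m x y)) ` W) \<le> card W" .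
    qed
    then show ?thesis by (simp add: L)
  qed
  have dec: "F m = F' m"
    if "m \<in> {1, 2}" "s \<in> space (strategy C)" "F \<in> file_tuples C" "F' \<in> file_tuples C"
      "0 < S.prob {s' \<in> space (strategy C). queries m s' = queries m s}"
      "answer_map C 1 (query_map C 1 m s) F = answer_map C 1 (query_map C 1 m s) F'"
      "answer_map C 2 (query_map C 2 m s) F = answer_map C 2 (query_map C 2 m s) F'"
    for m s F F'
    by (rule decodable[OF ent, of m s]) (use that in \<open>auto simp only: servers files insert_iff empty_iff\<close>)
  have int: "integrable (strategy C) (\<lambda>s. f (query_map C l m s))"
    if "l \<in> {1, 2}" "m \<in> {1, 2}" for l m and f :: "'q \<Rightarrow> real"
    by (rule integrable_query) (use that in \<open>simp_all only: servers files\<close>)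
  \<comment> \<open>Here \<open>u\<close> and \<open>v\<close> stand for the two answer lengths in
    bits. They are exchanged in the second premise, which comes from the bound with the servers
    swapped.\<close>
  have average: "c + (x + y) / 2 \<le> u + v" if "c + x \<le> u + v" "c + y \<le> v + u" for c x y u v :: real
    using that by (simp add: field_simps)
  \<comment> \<open>File \<open>m\<close> is both requested and held fixed in \<open>h\<close>. It
    can be decoded, so \<open>avg_log_range_decode_fst\<close> applies for almost every strategy,
    once with each server in the role of \<open>f\<close>.\<close>
  have requested: "L + (E 1 m (h m 1) + E 2 m (h m 2)) / 2 \<le> D m"
    if m: "m \<in> {1, 2}" for m
  proof -
    have "(\<integral>s. L + (h m 1 (query_map C 1 m s) + h m 2 (query_map C 2 m s)) / 2 \<partial>strategy C) \<le>
      (\<integral>s. a * answer_length C 1 (query_map C 1 m s) + a * answer_length C 2 (query_map C 2 m s) \<partial>strategy C)"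
    proof (rule integral_mono_AE)
      show "AE s in strategy C. L + (h m 1 (query_map C 1 m s) + h m 2 (query_map C 2 m s)) / 2 \<le>
        a * answer_length C 1 (query_map C 1 m s) + a * answer_length C 2 (query_map C 2 m s)"
        using AE_queries_pos[OF m[folded files]]
      proof (rule AE_mp, intro AE_I2 impI)
        fix s assume s: "s \<in> space (strategy C)"
          and pos: "0 < S.prob {s' \<in> space (strategy C). queries m s' = queries m s}"
        let ?f = "\<lambda>x y. answer_map C 1 (query_map C 1 m s) (place_files m x y)"
        let ?g = "\<lambda>x y. answer_map C 2 (query_map C 2 m s) (place_files m x y)"
        have q: "query_map C 1 m s \<in> query_alphabet C 1" "query_map C 2 m s \<in> query_alphabet C 2"
          using query_in_alphabet[OF _ _ s, unfolded files servers] m by auto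
        have f: "?f x y \<in> words (answer_length C 1 (query_map C 1 m s)) (answer_symbols C)"
          if "x \<in> W" "y \<in> W" for x y using answers[OF _ q(1) place[OF that]] by simp
        have g: "?g x y \<in> words (answer_length C 2 (query_map C 2 m s)) (answer_symbols C)"
          if "x \<in> W" "y \<in> W" for x y using answers[OF _ q(2) place[OF that]] by simp
        have d: "x = x'" if "x \<in> W" "y \<in> W" "x' \<in> W" "y' \<in> W" "?f x y = ?f x' y'" "?g x y = ?g x' y'"
          for x y x' y'
          using dec[OF m s place[OF that(1,2)] place[OF that(3,4)] pos that(5,6)]
          by (simp add: place_m[OF m])
        have "log 2 (card W) + avg_log_range W ?f \<le>
            log 2 (card (words (answer_length C 1 (query_map C 1 m s)) (answer_symbols C))) +
            log 2 (card (words (answer_length C 2 (query_map C 2 m s)) (answer_symbols C)))"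
          by (rule avg_log_range_decode_fst[OF W finite_words[OF symbols(1)] finite_words[OF symbols(1)] f g d])
        moreover have "log 2 (card W) + avg_log_range W ?g \<le>
            log 2 (card (words (answer_length C 2 (query_map C 2 m s)) (answer_symbols C))) +
            log 2 (card (words (answer_length C 1 (query_map C 1 m s)) (answer_symbols C)))"
          by (rule avg_log_range_decode_fst[OF W finite_words[OF symbols(1)] finite_words[OF symbols(1)] g f d])
        ultimately show "L + (h m 1 (query_map C 1 m s) + h m 2 (query_map C 2 m s)) / 2 \<le>
            a * answer_length C 1 (query_map C 1 m s) + a * answer_length C 2 (query_map C 2 m s)"
          unfolding L log_words h_def by (rule average)
      qed
    qed (use int[of 1 m "h m 1"] int[of 2 m "h m 2"] int[of 1 m "\<lambda>q. a * answer_length C 1 q"]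
        int[of 2 m "\<lambda>q. a * answer_length C 2 q"] m in \<open>simp_all del: integrable_mult_right_iff\<close>)
    then show ?thesis
      using int[of 1 m "h m 1"] int[of 2 m "h m 2"] int[of 1 m "\<lambda>q. a * answer_length C 1 q"]
        int[of 2 m "\<lambda>q. a * answer_length C 2 q"] m
      by (simp add: E_def D_def S.prob_space)
  qed
  \<comment> \<open>The file with index \<open>3 - m\<close> is requested while \<open>h\<close>
    still holds file \<open>m\<close> fixed. Decoding now recovers the varying file, so
    \<open>avg_log_range_decode_snd\<close> applies.\<close>
  have other: "L \<le> E 1 (3 - m) (h m 1) + E 2 (3 - m) (h m 2)" if m: "m \<in> {1, 2}" for m
  proof -
    have m': "3 - m \<in> {1, 2}" using m by auto
    have "(\<integral>s. L \<partial>strategy C) \<le>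
        (\<integral>s. h m 1 (query_map C 1 (3 - m) s) + h m 2 (query_map C 2 (3 - m) s) \<partial>strategy C)"
    proof (rule integral_mono_AE)
      show "AE s in strategy C. L \<le> h m 1 (query_map C 1 (3 - m) s) + h m 2 (query_map C 2 (3 - m) s)"
        using AE_queries_pos[OF m'[folded files]]
      proof (rule AE_mp, intro AE_I2 impI)
        fix s assume s: "s \<in> space (strategy C)"
          and pos: "0 < S.prob {s' \<in> space (strategy C). queries (3 - m) s' = queries (3 - m) s}"
        show "L \<le> h m 1 (query_map C 1 (3 - m) s) + h m 2 (query_map C 2 (3 - m) s)"
          unfolding h_def L[symmetric]
        proof (rule avg_log_range_decode_snd[OF W])
          fix x y y' assume xy: "x \<in> W" "y \<in> W" "y' \<in> W"
            and "answer_map C 1 (query_map C 1 (3 - m) s) (place_files m x y) =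
              answer_map C 1 (query_map C 1 (3 - m) s) (place_files m x y')"
            and "answer_map C 2 (query_map C 2 (3 - m) s) (place_files m x y) =
              answer_map C 2 (query_map C 2 (3 - m) s) (place_files m x y')"
          from dec[OF m' s place[OF xy(1,2)] place[OF xy(1,3)] pos this(4,5)] this(4,5)
          show "y = y'" by (simp add: place_m[OF m])
        qed
      qed
    qed (use int[of 1 "3 - m" "h m 1"] int[of 2 "3 - m" "h m 2"] m' in simp_all)
    then show ?thesis
      using int[of 1 "3 - m" "h m 1"] int[of 2 "3 - m" "h m 2"] m'
      by (simp add: E_def S.prob_space)
  qed
  \<comment> \<open>The same function of the query is averaged under both requests, which a server
    can tell apart only as far as its leakage allows.\<close>
  have transfer: "E l (3 - m) (h m l) - E l m (h m l) \<le> L * (2 powr leakage C l - 1)"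
    if "l \<in> {1, 2}" "m \<in> {1, 2}" for l m
    unfolding E_def powr_leakage[OF that(1)]
    by (rule expectation_diff_le) (use that h0 hL L0 in auto)
  have cost: "download_cost C = (D 1 + D 2) / 2"
    unfolding download_cost_eq D_def E_def a_def by (simp add: field_simps)
  have E0: "0 \<le> E l m (h m l)" for l m
    unfolding E_def by (simp add: h0)
  show "L \<le> download_cost C"
    using requested[of 1] requested[of 2] E0[of 1 1] E0[of 2 1] E0[of 1 2] E0[of 2 2]
    unfolding cost by (simp add: field_simps)
  \<comment> \<open>In \<open>requested\<close> the expectations are moved to the other request by
    \<open>transfer\<close> and then bounded by \<open>other\<close>.\<close>
  have "L + (L - L * (2 powr leakage C 1 - 1) - L * (2 powr leakage C 2 - 1)) / 2 \<le> D m"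
    if m: "m \<in> {1, 2}" for m
    using requested[OF m] other[OF m] transfer[OF _ m, of 1] transfer[OF _ m, of 2] by (simp add: field_simps)
  from this[of 1] this[of 2]
  show "L * (5 / 2 - (2 powr leakage C 1 + 2 powr leakage C 2) / 2) \<le> download_cost C"
    unfolding cost by (simp add: field_simps)
qed

section \<open>Upper bounds on the rate\<close>

lemma finite_answer_alphabet:
  assumes "finite (query_alphabet C l)" "finite (answer_symbols C)"
  shows "finite (answer_alphabet C l)"
  unfolding answer_alphabet_def using assms finite_words by blast

text \<open>Leaving out \<open>[]\<close> relaxes the size constraint, so upper bounds on the rate
  need only be shown for \<open>transmitted_answers\<close>.\<close>

lemma wpir_2_2_answer_alphabet_subset:
  fixes \<X> :: "'x set"
  shows "(wpir_2_2 answer_alphabet \<X> \<alpha> \<beta> :: ('s, 'q, 'x, 'a) ir_scheme set) \<subseteq>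
    wpir_2_2 transmitted_answers \<X> \<alpha> \<beta>"
proof
  fix C :: "('s, 'q, 'x, 'a) ir_scheme"
  assume C: "C \<in> wpir_2_2 answer_alphabet \<X> \<alpha> \<beta>"
  have "card (transmitted_answers C l) \<le> card (answer_alphabet C l)" if "l \<in> {1, 2}" for l
    unfolding transmitted_answers_def
    by (rule card_mono[OF finite_answer_alphabet]) (use that C in \<open>auto simp: wpir_2_2_def ir_scheme_def\<close>)
  then show "C \<in> wpir_2_2 transmitted_answers \<X> \<alpha> \<beta>"
    using C unfolding wpir_2_2_def by (auto intro: order_trans)
qed

lemma rate_le:
  assumes C: "C \<in> wpir_2_2 transmitted_answers \<X> \<alpha> \<beta>"
  shows "rate C \<le> 1"
    and "0 < 5 / 2 - (2 powr leakage C 1 + 2 powr leakage C 2) / 2 \<Longrightarrow>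
      rate C \<le> inverse (5 / 2 - (2 powr leakage C 1 + 2 powr leakage C 2) / 2)"
proof -
  have ir: "ir_scheme C" and two: "num_files C = 2" "num_servers C = 2"
    and small: "\<And>l. l \<in> {1, 2} \<Longrightarrow>
      card (transmitted_answers C l) \<le> card (file_alphabet C) ^ file_size C"
    using C unfolding wpir_2_2_def by auto
  have files: "finite (file_alphabet C)" "2 \<le> card (file_alphabet C)" "1 \<le> file_size C"
    and symbols: "finite (answer_symbols C)" "answer_symbols C \<noteq> {}"
    using ir unfolding ir_scheme_def by auto
  have servers: "{1..num_servers C} = {1, 2}" unfolding two by auto
  interpret scheme_2_2 C
  proof (intro scheme_2_2.intro query_scheme.intro scheme_2_2_axioms.intro)
    show "file_alphabet C \<noteq> {}" using files by auto
    show "prob_space (strategy C)" using ir by (simp add: ir_scheme_def)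
  qed (use ir two in \<open>auto simp: ir_scheme_def\<close>)
  \<comment> \<open>All words of a positive answer length are transmitted answers and hence counted.
    Length 0 admits a single word, for which the bound is trivial.\<close>
  have small': "card (answer_symbols C) ^ answer_length C l q \<le> card (file_alphabet C) ^ file_size C"
    if lq: "l \<in> {1, 2}" "q \<in> query_alphabet C l" for l q
  proof (cases "answer_length C l q = 0")
    case True
    then show ?thesis using files by simp
  next
    case False
    then have "words (answer_length C l q) (answer_symbols C) \<subseteq> transmitted_answers C l"
      using lq unfolding transmitted_answers_def answer_alphabet_def by (auto simp: words_def)
    moreover have "finite (transmitted_answers C l)"
      unfolding transmitted_answers_def
      using finite_answer_alphabet[OF finite_queries symbols(1)] lq(1) two by auto
    ultimately have "card (words (answer_length C l q) (answer_symbols C)) \<le> card (transmitted_answers C l)"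
      by (intro card_mono)
    then show ?thesis using small[OF lq(1)] by (simp add: card_words[OF symbols(1)])
  qed
  let ?L = "file_size C * log 2 (card (file_alphabet C))"
  have answers: "answer_map C l q F \<in> words (answer_length C l q) (answer_symbols C)"
    if "l \<in> {1, 2}" "q \<in> query_alphabet C l" "F \<in> file_tuples C" for l q F
    using ir that servers unfolding ir_scheme_def by blast
  have ent: "cond_entropy (ir_space C) requested_file (retrieved C) = 0"
    using ir by (simp add: ir_scheme_def)
  have L: "0 < ?L" using files by simp
  have bound: "rate C \<le> inverse c" if "0 < c" "?L * c \<le> download_cost C" for c
  proof -
    have "0 < ?L * c" using L that(1) by (rule mult_pos_pos)
    then have "rate C \<le> ?L / (?L * c)"
      unfolding rate_def using that(2) L by (intro divide_left_mono) auto
    also have "\<dots> = inverse c"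
      unfolding inverse_eq_divide by (rule nonzero_divide_mult_cancel_left) (use L in linarith)
    finally show ?thesis .
  qed
  show "rate C \<le> 1"
    using bound[of 1] download_cost_ge(1)[OF files(2) symbols answers small' ent] by simp
  show "rate C \<le> inverse (5 / 2 - (2 powr leakage C 1 + 2 powr leakage C 2) / 2)"
    if "0 < 5 / 2 - (2 powr leakage C 1 + 2 powr leakage C 2) / 2"
    using that by (rule bound) (rule download_cost_ge(2)[OF files(2) symbols answers small' ent])
qed

lemma max_leakage_eq: "num_servers C = 2 \<Longrightarrow> max_leakage C = max (leakage C 1) (leakage C 2)"
proof -
  assume "num_servers C = 2"
  then have "{1..num_servers C} = {1, 2}" by auto
  then show ?thesis by (simp add: max_leakage_def)
qed

subsection \<open>Achievability\<close>

text \<open>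
  The query codes \<open>0\<close>, \<open>1\<close>, \<open>2\<close>, \<open>3\<close> ask for nothing, the first file, the second file and a
  combination of both files. Row \<open>l\<close>, \<open>m\<close> lists the code sent to server \<open>l\<close> for each of the four
  values of the strategy when file \<open>m\<close> is requested.
\<close>

definition query_code :: "nat \<Rightarrow> nat \<Rightarrow> nat \<Rightarrow> nat" where
  "query_code l m i =
     (if l = 1 then (if m = 1 then [0, 1, 2, 3] else [0, 2, 1, 3])
      else (if m = 1 then [1, 0, 3, 2] else [2, 0, 3, 1])) ! (i mod 4)"

text \<open>The answers are left abstract since two answer maps are needed, depending on whether
  \<open>[]\<close> counts. The decoding assumptions list the unordered pairs of codes sent for each
  request. The weights \<open>w 0\<close> and \<open>w 1\<close> belong to the cheap pairs with code
  0, \<open>w 2\<close> and \<open>w 3\<close> to the others; \<open>e\<close> and \<open>k\<close>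
  embed the numbers into the types of strategies and queries.\<close>

locale leaky_scheme =
  fixes e :: "nat \<Rightarrow> 's" and k :: "nat \<Rightarrow> 'q" and w :: "nat \<Rightarrow> real"
    and \<X> :: "'x set" and \<beta> :: nat and A :: "'a set"
    and len :: "nat \<Rightarrow> nat" and ans :: "nat \<Rightarrow> (nat \<Rightarrow> 'x list) \<Rightarrow> 'a list"
  assumes inj_e: "inj e" and inj_k: "inj k"
    and w_nonneg: "0 \<le> w 0" "0 \<le> w 1" "0 \<le> w 2" "0 \<le> w 3"
    and w_sum: "w 0 + w 1 + w 2 + w 3 = 1"
    and files: "finite \<X>" "2 \<le> card \<X>" "1 \<le> \<beta>"
    and symbols: "finite A" "A \<noteq> {}"
    and answers: "\<And>i F. i < 4 \<Longrightarrow> F \<in> (\<Pi>\<^sub>E m\<in>{1..2}. words \<beta> \<X>) \<Longrightarrow> ans i F \<in> words (len i) A"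
    and decode_1: "\<And>i j F F'. (i, j) \<in> {(0, 1), (2, 3)} \<Longrightarrow>
        F \<in> (\<Pi>\<^sub>E m\<in>{1..2}. words \<beta> \<X>) \<Longrightarrow> F' \<in> (\<Pi>\<^sub>E m\<in>{1..2}. words \<beta> \<X>) \<Longrightarrow>
        ans i F = ans i F' \<Longrightarrow> ans j F = ans j F' \<Longrightarrow> F 1 = F' 1"
    and decode_2: "\<And>i j F F'. (i, j) \<in> {(0, 2), (1, 3)} \<Longrightarrow>
        F \<in> (\<Pi>\<^sub>E m\<in>{1..2}. words \<beta> \<X>) \<Longrightarrow> F' \<in> (\<Pi>\<^sub>E m\<in>{1..2}. words \<beta> \<X>) \<Longrightarrow>
        ans i F = ans i F' \<Longrightarrow> ans j F = ans j F' \<Longrightarrow> F 2 = F' 2"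
begin

definition strategy_pmf :: "'s pmf" where
  "strategy_pmf = pmf_of_list [(e 0, w 0), (e 1, w 1), (e 2, w 2), (e 3, w 3)]"

definition scheme :: "('s, 'q, 'x, 'a) ir_scheme" where
  "scheme = \<lparr>num_files = 2, num_servers = 2, file_alphabet = \<X>, file_size = \<beta>,
     strategy = measure_pmf strategy_pmf, query_alphabet = \<lambda>_. k ` {..<4},
     query_map = \<lambda>l m s. k (query_code l m (inv e s)),
     answer_length = \<lambda>_ q. len (inv k q), answer_symbols = A,
     answer_map = \<lambda>_ q. ans (inv k q)\<rparr>"

lemma scheme_simps [simp]:
  "num_files scheme = 2" "num_servers scheme = 2" "file_alphabet scheme = \<X>" "file_size scheme = \<beta>"
  "strategy scheme = measure_pmf strategy_pmf" "query_alphabet scheme l = k ` {..<4}"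
  "query_map scheme l m s = k (query_code l m (inv e s))"
  "answer_length scheme l q = len (inv k q)" "answer_symbols scheme = A"
  "answer_map scheme l q = ans (inv k q)"
  by (simp_all add: scheme_def)

lemma lessThan_4: "{..<4::nat} = {0, 1, 2, 3}"
  by auto

lemma mod_4_cases: obtains "i mod 4 = (0::nat)" | "i mod 4 = 1" | "i mod 4 = 2" | "i mod 4 = 3"
  by atomize_elim presburger

text \<open>The reduction modulo 4 matters here: the strategy space is the whole type, so strategies
  of probability zero must also lead to queries in the alphabet.\<close>

lemma query_code_less: "query_code l m i < 4"
  by (cases i rule: mod_4_cases) (auto simp: query_code_def)

lemma prob_strategy_pmf:
  "measure_pmf.prob strategy_pmf {s. P (inv e s)} =
    (if P 0 then w 0 else 0) + (if P 1 then w 1 else 0) + (if P 2 then w 2 else 0) + (if P 3 then w 3 else 0)"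
proof -
  have "pmf_of_list_wf [(e 0, w 0), (e 1, w 1), (e 2, w 2), (e 3, w 3)]"
    using w_nonneg w_sum by (auto simp: pmf_of_list_wf_def)
  then show ?thesis
    unfolding strategy_pmf_def by (simp add: measure_pmf_of_list inj_e)
qed

sublocale scheme_2_2 scheme
proof (intro scheme_2_2.intro query_scheme.intro scheme_2_2_axioms.intro)
  show "file_alphabet scheme \<noteq> {}" using files by auto
  show "prob_space (strategy scheme)" by (simp add: measure_pmf.prob_space_axioms)
  show "query_map scheme l m \<in> strategy scheme \<rightarrow>\<^sub>M count_space (query_alphabet scheme l)" for l m
    using query_code_less by (simp add: measurable_pmf_measure1)
qed (use files in auto)

lemma query_prob_eq:
  "query_prob l m (k j) =
    (if query_code l m 0 = j then w 0 else 0) + (if query_code l m 1 = j then w 1 else 0) +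
    (if query_code l m 2 = j then w 2 else 0) + (if query_code l m 3 = j then w 3 else 0)"
  using prob_strategy_pmf[of "\<lambda>i. query_code l m i = j"]
  by (simp add: query_prob_def inj_eq[OF inj_k])

lemma sum_query_alphabet:
  "(\<Sum>q\<in>query_alphabet scheme l. f q) = f (k 0) + f (k 1) + f (k 2) + (f (k 3) :: real)"
  by (simp add: sum.reindex inj_on_subset[OF inj_k] lessThan_4 inj_eq[OF inj_k])

text \<open>At server 1 the codes 1 and 2 have probabilities \<open>w 1\<close> and
  \<open>w 2\<close>, swapped by a change of request; at server 2 these are \<open>w 0\<close> and
  \<open>w 3\<close>. Codes 0 and 3 keep their probabilities. So server 1 is private for
  \<open>w 1 = w 2\<close> and server 2 for \<open>w 0 = w 3\<close>.\<close>

lemma leakage_scheme: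
  "leakage scheme 1 = log 2 (w 0 + 2 * max (w 1) (w 2) + w 3)"
  "leakage scheme 2 = log 2 (w 1 + w 2 + 2 * max (w 0) (w 3))"
proof -
  have "leakage scheme l = log 2 (\<Sum>q\<in>query_alphabet scheme l. max (query_prob l 1 q) (query_prob l 2 q))"
    if "l \<in> {1, 2}" for l
    using leakage_eq[OF that] by (simp only: max_prob_sum_def)
  note this[of 1] this[of 2]
  then show "leakage scheme 1 = log 2 (w 0 + 2 * max (w 1) (w 2) + w 3)"
    "leakage scheme 2 = log 2 (w 1 + w 2 + 2 * max (w 0) (w 3))"
    unfolding sum_query_alphabet query_prob_eq
    by (simp_all add: query_code_def max.commute algebra_simps)
qed

lemma expectation_scheme:
  fixes f :: "'q \<Rightarrow> real"
  assumes "l \<in> {1, 2}" "m \<in> {1, 2}"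
  shows "(\<integral>s. f (query_map scheme l m s) \<partial>strategy scheme) =
    query_prob l m (k 0) * f (k 0) + query_prob l m (k 1) * f (k 1) +
    query_prob l m (k 2) * f (k 2) + query_prob l m (k 3) * f (k 3)"
proof -
  have "l \<in> {1..num_servers scheme}" "m \<in> {1..num_files scheme}" using assms by auto
  then show ?thesis
    by (simp only: expectation_query_map sum_query_alphabet query_prob_def)
qed

text \<open>Strategy values 0 and 1 send code 0 to exactly one server, values 2 and 3 to
  none.\<close>

lemma download_cost_scheme:
  assumes "len 1 = len 3" "len 2 = len 3"
  shows "download_cost scheme =
    log 2 (card A) * ((len 0 + len 3) * (w 0 + w 1) + 2 * len 3 * (w 2 + w 3))"
  unfolding download_cost_eq
  using expectation_scheme[of 1 1 "\<lambda>q. log 2 (card A) * len (inv k q)"]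
    expectation_scheme[of 1 2 "\<lambda>q. log 2 (card A) * len (inv k q)"]
    expectation_scheme[of 2 1 "\<lambda>q. log 2 (card A) * len (inv k q)"]
    expectation_scheme[of 2 2 "\<lambda>q. log 2 (card A) * len (inv k q)"]
  by (simp add: query_prob_eq query_code_def assms[simplified] inj_k field_simps)

lemma file_tuples_scheme: "file_tuples scheme = (\<Pi>\<^sub>E m\<in>{1..2}. words \<beta> \<X>)"
  by (simp add: file_tuples_def)

lemma ir_scheme_scheme: "ir_scheme scheme"
proof -
  have "cond_entropy (ir_space scheme) requested_file (retrieved scheme) = 0"
  proof (rule cond_entropy_eq_0I)
    fix m s and F F' :: "nat \<Rightarrow> 'x list"
    assume m: "m \<in> {1..num_files scheme}"
      and F: "F \<in> file_tuples scheme" "F' \<in> file_tuples scheme"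
      and eq: "\<And>l. l \<in> {1..num_servers scheme} \<Longrightarrow>
        answer_map scheme l (query_map scheme l m s) F = answer_map scheme l (query_map scheme l m s) F'"
    let ?i = "query_code 1 m (inv e s)" and ?j = "query_code 2 m (inv e s)"
    have eq': "ans ?i F = ans ?i F'" "ans ?j F = ans ?j F'"
      using eq[of 1] eq[of 2] by (simp_all add: inj_k)
    consider "m = 1" | "m = 2" using m by force
    then show "F m = F' m"
    proof cases
      case 1
      then have "(?i, ?j) \<in> {(0, 1), (2, 3)} \<or> (?j, ?i) \<in> {(0, 1), (2, 3)}"
        by (cases "inv e s" rule: mod_4_cases) (auto simp: query_code_def)
      then show ?thesis
        using decode_1 F eq' unfolding 1 file_tuples_scheme by blast
    next
      case 2
      then have "(?i, ?j) \<in> {(0, 2), (1, 3)} \<or> (?j, ?i) \<in> {(0, 2), (1, 3)}"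
        by (cases "inv e s" rule: mod_4_cases) (auto simp: query_code_def)
      then show ?thesis
        using decode_2 F eq' unfolding 2 file_tuples_scheme by blast
    qed
  qed
  moreover have "answer_map scheme l q F \<in> words (answer_length scheme l q) (answer_symbols scheme)"
    if "q \<in> query_alphabet scheme l" "F \<in> file_tuples scheme" for l q F
    using that answers unfolding file_tuples_scheme by (auto simp: inj_k)
  ultimately show ?thesis
    unfolding ir_scheme_def
    using files symbols measurable_query_map prob_strategy by simp
qed

lemma answer_alphabet_scheme: "answer_alphabet scheme l = (\<Union>i<4. words (len i) A)"
  by (simp add: answer_alphabet_def inj_k)

lemma scheme_in_wpir_2_2:
  assumes "4 \<le> \<alpha>" "\<And>l. l \<in> {1, 2} \<Longrightarrow> card (alph scheme l) \<le> card \<X> ^ \<beta>"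
  shows "scheme \<in> wpir_2_2 alph \<X> \<alpha> \<beta>"
proof -
  have "card (k ` {..<4}) = 4"
    by (simp add: card_image inj_on_subset[OF inj_k])
  then show ?thesis
    using assms ir_scheme_scheme by (simp add: wpir_2_2_def)
qed

end

text \<open>This operation replaces the sum of two files, as \<X> carries no algebraic structure.
  Cancellation recovers either file from the other one and the combination.\<close>

definition quasigroup_on :: "'w set \<Rightarrow> ('w \<Rightarrow> 'w \<Rightarrow> 'w) \<Rightarrow> bool" where
  "quasigroup_on W f \<longleftrightarrow> (\<forall>x\<in>W. \<forall>y\<in>W. f x y \<in> W) \<and>
     (\<forall>x\<in>W. inj_on (f x) W) \<and> (\<forall>y\<in>W. inj_on (\<lambda>x. f x y) W)"

lemma quasigroup_onD:
  assumes "quasigroup_on W f"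
  shows "x \<in> W \<Longrightarrow> y \<in> W \<Longrightarrow> f x y \<in> W"
    and "x \<in> W \<Longrightarrow> y \<in> W \<Longrightarrow> z \<in> W \<Longrightarrow> f x y = f x z \<Longrightarrow> y = z"
    and "x \<in> W \<Longrightarrow> y \<in> W \<Longrightarrow> z \<in> W \<Longrightarrow> f x z = f y z \<Longrightarrow> x = y"
  using assms unfolding quasigroup_on_def inj_on_def by blast+

text \<open>Addition modulo \<open>card W\<close> is carried over to \<open>W\<close> along a
  bijection.\<close>

lemma quasigroup_exists:
  assumes "finite W"
  shows "\<exists>f. quasigroup_on W f"
proof -
  obtain h where h: "bij_betw h W {0..<card W}"
    using ex_bij_betw_finite_nat[OF assms] by blast
  define f where "f x y = inv_into W h ((h x + h y) mod card W)" for x y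
  have hW: "h x < card W" if "x \<in> W" for x
    using bij_betwE[OF h] that by auto
  have hf: "f x y \<in> W \<and> h (f x y) = (h x + h y) mod card W" if "x \<in> W" "y \<in> W" for x y
  proof -
    have "card W > 0" using that assms by (auto simp: card_gt_0_iff)
    then have "(h x + h y) mod card W \<in> h ` W" using h by (simp add: bij_betw_def)
    then show ?thesis unfolding f_def by (simp add: inv_into_into f_inv_into_f)
  qed
  have cancel: "b = c" if "(a + b) mod n = (a + c) mod n" "b < n" "c < n" for a b c n :: nat
  proof -
    have "b = c" if "b \<le> c" "(a + b) mod n = (a + c) mod n" "c < n" for b c
    proof -
      have "n dvd c - b"
        using mod_eq_dvd_iff_nat[of "a + b" "a + c" n] that(1,2) by simp
      then show ?thesis using that(1,3) dvd_imp_le[of n "c - b"] by linarith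
    qed
    from this[of b c] this[of c b] show ?thesis using that by (cases "b \<le> c") auto
  qed
  have inj: "x = y" if "h x = h y" "x \<in> W" "y \<in> W" for x y
    using h that by (auto simp: bij_betw_def dest: inj_onD)
  have "quasigroup_on W f"
    unfolding quasigroup_on_def
  proof (intro conjI ballI inj_onI)
    fix x y z assume x: "x \<in> W" "y \<in> W" "z \<in> W" and "f x y = f x z"
    then have "h (f x y) = h (f x z)" by simp
    then have "(h x + h y) mod card W = (h x + h z) mod card W"
      using hf[OF x(1,2)] hf[OF x(1,3)] by simp
    then have "h y = h z" by (rule cancel) (use x hW in auto)
    then show "y = z" using x(2,3) by (rule inj)
  next
    fix z x y assume x: "z \<in> W" "x \<in> W" "y \<in> W" and "f x z = f y z"
    then have "h (f x z) = h (f y z)" by simp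
    then have "(h z + h x) mod card W = (h z + h y) mod card W"
      using hf[OF x(2,1)] hf[OF x(3,1)] by (simp add: add.commute)
    then have "h x = h y" by (rule cancel) (use x hW in auto)
    then show "x = y" using x(2,3) by (rule inj)
  qed (use hf in auto)
  then show ?thesis by blast
qed

text \<open>A whole file value is encoded as a single answer symbol, so an answer is
  \<open>[]\<close> or one of \<open>card \<X> ^ \<beta>\<close> one-letter words. Cheap pairs cost
  one file and the others two, whence the factor \<open>1 + w 2 + w 3\<close>.\<close>

lemma exact_scheme_exists:
  fixes \<X> :: "'x set" and w :: "nat \<Rightarrow> real"
  assumes \<X>: "finite \<X>" "2 \<le> card \<X>" and \<beta>: "1 \<le> \<beta>" and \<alpha>: "4 \<le> \<alpha>"
    and w: "0 \<le> w 0" "0 \<le> w 1" "0 \<le> w 2" "0 \<le> w 3" "w 0 + w 1 + w 2 + w 3 = 1"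
  shows "\<exists>C \<in> wpir_2_2 transmitted_answers \<X> \<alpha> \<beta> :: ('s::infinite, 'q::infinite, 'x, 'a::infinite) ir_scheme set.
    leakage C 1 = log 2 (w 0 + 2 * max (w 1) (w 2) + w 3) \<and>
    leakage C 2 = log 2 (w 1 + w 2 + 2 * max (w 0) (w 3)) \<and>
    rate C = inverse (1 + w 2 + w 3)"
proof -
  define W where "W = words \<beta> \<X>"
  have finW: "finite W" unfolding W_def by (rule finite_words[OF \<X>(1)])
  have cardW: "card W = card \<X> ^ \<beta>" unfolding W_def by (rule card_words[OF \<X>(1)])
  obtain e :: "nat \<Rightarrow> 's" where e: "inj e"
    using arb_countable_map[of "{}"] by auto
  obtain k :: "nat \<Rightarrow> 'q" where k: "inj k"
    using arb_countable_map[of "{}"] by auto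
  obtain f :: "'x list \<Rightarrow> 'a" where f: "inj_on f W"
    using arb_inj_on_finite_infinite[OF finW] by blast
  obtain g where "quasigroup_on W g"
    using quasigroup_exists[OF finW] by blast
  note g = quasigroup_onD[OF this]
  define len :: "nat \<Rightarrow> nat" where "len i = (if i = 0 then 0 else 1)" for i
  define ans where "ans i F =
    (if i = 0 then [] else [f (if i = 1 then F 1 else if i = 2 then F 2 else g (F 1) (F 2))])"
    for i :: nat and F :: "nat \<Rightarrow> 'x list"
  have F: "F 1 \<in> W" "F 2 \<in> W" if "F \<in> (\<Pi>\<^sub>E m\<in>{1..2}. words \<beta> \<X>)"
    for F :: "nat \<Rightarrow> 'x list"
    using that unfolding W_def by (auto simp: PiE_iff)
  have cardA: "card (f ` W) = card \<X> ^ \<beta>" using cardW f by (simp add: card_image)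
  interpret leaky_scheme e k w \<X> \<beta> "f ` W" len ans
  proof
    have "0 < card W" using \<X> by (simp add: cardW)
    then show "f ` W \<noteq> {}" by auto
    show "ans i F \<in> words (len i) (f ` W)"
      if "F \<in> (\<Pi>\<^sub>E m\<in>{1..2}. words \<beta> \<X>)" for i F
      using F[OF that] g(1) by (auto simp: ans_def len_def words_def)
  next
    fix i j F F' assume ij: "(i, j) \<in> {(0::nat, 1::nat), (2, 3)}"
      and "F \<in> (\<Pi>\<^sub>E m\<in>{1..2}. words \<beta> \<X>)" "F' \<in> (\<Pi>\<^sub>E m\<in>{1..2}. words \<beta> \<X>)"
      and eq: "ans i F = ans i F'" "ans j F = ans j F'"
    note W = F[OF this(2)] F[OF this(3)]
    from ij eq show "F 1 = F' 1"
      using W g(1) g(3)[of "F 1" "F' 1" "F 2"] by (auto simp: ans_def inj_on_eq_iff[OF f])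
  next
    fix i j F F' assume ij: "(i, j) \<in> {(0::nat, 2::nat), (1, 3)}"
      and "F \<in> (\<Pi>\<^sub>E m\<in>{1..2}. words \<beta> \<X>)" "F' \<in> (\<Pi>\<^sub>E m\<in>{1..2}. words \<beta> \<X>)"
      and eq: "ans i F = ans i F'" "ans j F = ans j F'"
    note W = F[OF this(2)] F[OF this(3)]
    from ij eq show "F 2 = F' 2"
      using W g(1) g(2)[of "F 1" "F 2" "F' 2"] by (auto simp: ans_def inj_on_eq_iff[OF f])
  qed (use e k w \<X> \<beta> finW in auto)
  have "card (transmitted_answers scheme l) \<le> card \<X> ^ \<beta>" for l
  proof -
    have "transmitted_answers scheme l \<subseteq> words 1 (f ` W)"
      unfolding transmitted_answers_def answer_alphabet_scheme
      by (auto simp: len_def words_def split: if_splits)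
    then have "card (transmitted_answers scheme l) \<le> card (words 1 (f ` W))"
      by (rule card_mono[rotated]) (use finW in \<open>auto simp: finite_words\<close>)
    then show ?thesis using finW by (simp add: card_words cardA)
  qed
  then have "scheme \<in> wpir_2_2 transmitted_answers \<X> \<alpha> \<beta>"
    by (intro scheme_in_wpir_2_2 \<alpha>)
  moreover have "rate scheme = inverse (1 + w 2 + w 3)"
  proof -
    have L: "0 < \<beta> * log 2 (card \<X>)" using \<X> \<beta> by simp
    have "download_cost scheme = log 2 (card (f ` W)) * ((w 0 + w 1) + 2 * (w 2 + w 3))"
      by (subst download_cost_scheme) (simp_all add: len_def)
    also have "log 2 (card (f ` W)) = \<beta> * log 2 (card \<X>)"
      using \<X> by (simp add: cardA log_nat_power)
    also have "(w 0 + w 1) + 2 * (w 2 + w 3) = 1 + w 2 + w 3" using w(5) by simp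
    finally have D: "download_cost scheme = \<beta> * log 2 (card \<X>) * (1 + w 2 + w 3)" .
    show ?thesis
      unfolding rate_def D scheme_simps inverse_eq_divide
      by (rule nonzero_divide_mult_cancel_left) (use L in linarith)
  qed
  ultimately show ?thesis using leakage_scheme by blast
qed

text \<open>
  Here \<open>[]\<close> counts towards the size of the answer alphabet, so no answer may be a full file. The
  last three symbols of each file are therefore treated separately: they are sent along with the
  empty query, and the remaining answers have room for two of these six symbols each.
\<close>

lemma approximate_scheme_exists:
  fixes \<X> :: "'x set" and w :: "nat \<Rightarrow> real"
  assumes \<X>: "finite \<X>" "2 \<le> card \<X>" and \<beta>: "7 \<le> \<beta>" and \<alpha>: "4 \<le> \<alpha>"
    and w: "0 \<le> w 0" "0 \<le> w 1" "0 \<le> w 2" "0 \<le> w 3" "w 0 + w 1 + w 2 + w 3 = 1"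
  shows "\<exists>C \<in> wpir_2_2 answer_alphabet \<X> \<alpha> \<beta> :: ('s::infinite, 'q::infinite, 'x, 'a::infinite) ir_scheme set.
    leakage C 1 = log 2 (w 0 + 2 * max (w 1) (w 2) + w 3) \<and>
    leakage C 2 = log 2 (w 1 + w 2 + 2 * max (w 0) (w 3)) \<and>
    rate C = \<beta> / ((real \<beta> + 5) * (w 0 + w 1) + 2 * (real \<beta> - 1) * (w 2 + w 3))"
proof -
  \<comment> \<open>As \<beta> is at least 7, the 6 symbols answering code 0 are at most the
    \<open>n + 2\<close> symbols of any other answer.\<close>
  define n where "n = \<beta> - 3"
  have \<beta>n: "\<beta> = n + 3" "4 \<le> n" using \<beta> by (auto simp: n_def)
  define W where "W = words n \<X>"
  have finW: "finite W" unfolding W_def by (rule finite_words[OF \<X>(1)])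
  obtain e :: "nat \<Rightarrow> 's" where e: "inj e"
    using arb_countable_map[of "{}"] by auto
  obtain k :: "nat \<Rightarrow> 'q" where k: "inj k"
    using arb_countable_map[of "{}"] by auto
  obtain f :: "'x \<Rightarrow> 'a" where f: "inj_on f \<X>"
    using arb_inj_on_finite_infinite[OF \<X>(1)] by blast
  obtain g where "quasigroup_on W g"
    using quasigroup_exists[OF finW] by blast
  note g = quasigroup_onD[OF this]
  define a where "a x = take n x" for x :: "'x list"
  define b where "b x = take 2 (drop n x)" for x :: "'x list"
  define c where "c x = drop (n + 2) x" for x :: "'x list"
  have "x = a x @ b x @ c x" for x
    unfolding a_def b_def c_def
    by (metis add.commute append_take_drop_id drop_drop)
  then have abc: "x = y" if "a x = a y" "b x = b y" "c x = c y" for x y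
    using that by metis
  have split: "a x \<in> W" "b x \<in> words 2 \<X>" "c x \<in> words 1 \<X>" if "x \<in> words \<beta> \<X>" for x
    using that set_take_subset[of n x] set_take_subset[of 2 "drop n x"] set_drop_subset[of n x]
      set_drop_subset[of "n + 2" x]
    by (auto simp: W_def words_def a_def b_def c_def \<beta>n)
  have len_split: "length (a x) = n" "length (b x) = 2" "length (c x) = 1" if "x \<in> words \<beta> \<X>" for x
    using split[OF that] by (auto simp: W_def words_def)
  have len_g: "length (g x y) = n" if "x \<in> W" "y \<in> W" for x y
    using g(1)[OF that] by (simp add: W_def words_def)
  define len :: "nat \<Rightarrow> nat" where "len i = (if i = 0 then 6 else n + 2)" for i
  \<comment> \<open>For file 1, codes 0 and 1 deliver \<open>b x\<close>, \<open>c x\<close> and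
    \<open>a x\<close>, while codes 2 and 3 deliver \<open>b x\<close>, \<open>c x\<close>,
    \<open>a y\<close> and the combination, from which \<open>a x\<close> follows by cancellation.
    File 2 is treated alike with the pairs 0, 2 and 1, 3.\<close>
  define raw where "raw i x y =
    (if i = 0 then (b x @ c x) @ (b y @ c y)
     else if i = 1 then a x @ b y
     else if i = 2 then a y @ b x
     else g (a x) (a y) @ (c x @ c y))" for i :: nat and x y
  define ans where "ans i F = map f (raw i (F 1) (F 2))" for i and F :: "nat \<Rightarrow> 'x list"
  have F: "F 1 \<in> words \<beta> \<X>" "F 2 \<in> words \<beta> \<X>" if "F \<in> (\<Pi>\<^sub>E m\<in>{1..2}. words \<beta> \<X>)"
    for F :: "nat \<Rightarrow> 'x list"
    using that by (auto simp: PiE_iff)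
  have raw: "raw i x y \<in> words (len i) \<X>" if "x \<in> words \<beta> \<X>" "y \<in> words \<beta> \<X>" for i x y
  proof -
    have "set (a x) \<subseteq> \<X>" "set (a y) \<subseteq> \<X>" "set (b x) \<subseteq> \<X>" "set (b y) \<subseteq> \<X>"
      "set (c x) \<subseteq> \<X>" "set (c y) \<subseteq> \<X>" "set (g (a x) (a y)) \<subseteq> \<X>"
      using split[OF that(1)] split[OF that(2)] g(1)[of "a x" "a y"] by (auto simp: W_def words_def)
    then show ?thesis
      using split(1)[OF that(1)] split(1)[OF that(2)]
      by (simp add: raw_def len_def words_def len_split[OF that(1)] len_split[OF that(2)] len_g)
  qed
  have raw_eq: "raw i x y = raw i x' y'"
    if "map f (raw i x y) = map f (raw i x' y')" "x \<in> words \<beta> \<X>" "y \<in> words \<beta> \<X>"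
      "x' \<in> words \<beta> \<X>" "y' \<in> words \<beta> \<X>" for i x y x' y'
  proof (rule map_inj_on[OF that(1)])
    show "inj_on f (set (raw i x y) \<union> set (raw i x' y'))"
      by (rule inj_on_subset[OF f])
        (use raw[OF that(2,3), of i] raw[OF that(4,5), of i] in \<open>auto simp: words_def\<close>)
  qed
  have raw_simps: "raw 0 x y = (b x @ c x) @ (b y @ c y)" "raw 1 x y = a x @ b y"
    "raw 2 x y = a y @ b x" "raw 3 x y = g (a x) (a y) @ (c x @ c y)" for x y
    by (simp_all add: raw_def)
  have decode_fst: "x = x'"
    if in_words: "x \<in> words \<beta> \<X>" "y \<in> words \<beta> \<X>" "x' \<in> words \<beta> \<X>" "y' \<in> words \<beta> \<X>"
      and eq: "(raw 0 x y = raw 0 x' y' \<and> raw 1 x y = raw 1 x' y') \<or>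
        (raw 2 x y = raw 2 x' y' \<and> raw 3 x y = raw 3 x' y')"
    for x y x' y'
  proof -
    note lens = len_split[OF in_words(1)] len_split[OF in_words(2)]
      len_split[OF in_words(3)] len_split[OF in_words(4)]
    note aW = split(1)[OF in_words(1)] split(1)[OF in_words(2)]
      split(1)[OF in_words(3)] split(1)[OF in_words(4)]
    note len_g' = len_g[OF aW(1,2)] len_g[OF aW(3,4)]
    from eq show ?thesis
    proof (elim disjE)
      assume "raw 0 x y = raw 0 x' y' \<and> raw 1 x y = raw 1 x' y'"
      then show ?thesis unfolding raw_simps by - (rule abc, auto simp: lens)
    next
      assume *: "raw 2 x y = raw 2 x' y' \<and> raw 3 x y = raw 3 x' y'"
      then have "a y = a y'" "b x = b x'" "g (a x) (a y) = g (a x') (a y')" "c x = c x'"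
        unfolding raw_simps by (auto simp: lens len_g')
      moreover from this have "a x = a x'" by (intro g(3)[OF aW(1,3,2)]) simp
      ultimately show ?thesis by (intro abc[of x x'])
    qed
  qed
  have decode_snd: "y = y'"
    if in_words: "x \<in> words \<beta> \<X>" "y \<in> words \<beta> \<X>" "x' \<in> words \<beta> \<X>" "y' \<in> words \<beta> \<X>"
      and eq: "(raw 0 x y = raw 0 x' y' \<and> raw 2 x y = raw 2 x' y') \<or>
        (raw 1 x y = raw 1 x' y' \<and> raw 3 x y = raw 3 x' y')"
    for x y x' y'
  proof -
    note lens = len_split[OF in_words(1)] len_split[OF in_words(2)]
      len_split[OF in_words(3)] len_split[OF in_words(4)]
    note aW = split(1)[OF in_words(1)] split(1)[OF in_words(2)]
      split(1)[OF in_words(3)] split(1)[OF in_words(4)]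
    note len_g' = len_g[OF aW(1,2)] len_g[OF aW(3,4)]
    from eq show ?thesis
    proof (elim disjE)
      assume "raw 0 x y = raw 0 x' y' \<and> raw 2 x y = raw 2 x' y'"
      then show ?thesis unfolding raw_simps by - (rule abc, auto simp: lens)
    next
      assume *: "raw 1 x y = raw 1 x' y' \<and> raw 3 x y = raw 3 x' y'"
      then have "a x = a x'" "b y = b y'" "g (a x) (a y) = g (a x') (a y')" "c y = c y'"
        unfolding raw_simps by (auto simp: lens len_g')
      moreover from this have "a y = a y'" by (intro g(2)[OF aW(1,2,4)]) simp
      ultimately show ?thesis by (intro abc[of y y'])
    qed
  qed
  interpret leaky_scheme e k w \<X> \<beta> "f ` \<X>" len ans
  proof
    show "f ` \<X> \<noteq> {}" using \<X> by auto
    show "ans i F \<in> words (len i) (f ` \<X>)"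
      if "F \<in> (\<Pi>\<^sub>E m\<in>{1..2}. words \<beta> \<X>)" for i F
      using raw[OF F[OF that], of i] by (auto simp: ans_def words_def)
  next
    fix i j F F' assume ij: "(i, j) \<in> {(0::nat, 1::nat), (2, 3)}"
      and "F \<in> (\<Pi>\<^sub>E m\<in>{1..2}. words \<beta> \<X>)" "F' \<in> (\<Pi>\<^sub>E m\<in>{1..2}. words \<beta> \<X>)"
      and eq: "ans i F = ans i F'" "ans j F = ans j F'"
    note F4 = F[OF this(2)] F[OF this(3)]
    have r: "raw i (F 1) (F 2) = raw i (F' 1) (F' 2)" "raw j (F 1) (F 2) = raw j (F' 1) (F' 2)"
      using raw_eq[OF _ F4] eq by (simp_all add: ans_def)
    show "F 1 = F' 1"
      by (rule decode_fst[OF F4]) (use ij r in auto)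
  next
    fix i j F F' assume ij: "(i, j) \<in> {(0::nat, 2::nat), (1, 3)}"
      and "F \<in> (\<Pi>\<^sub>E m\<in>{1..2}. words \<beta> \<X>)" "F' \<in> (\<Pi>\<^sub>E m\<in>{1..2}. words \<beta> \<X>)"
      and eq: "ans i F = ans i F'" "ans j F = ans j F'"
    note F4 = F[OF this(2)] F[OF this(3)]
    have r: "raw i (F 1) (F 2) = raw i (F' 1) (F' 2)" "raw j (F 1) (F 2) = raw j (F' 1) (F' 2)"
      using raw_eq[OF _ F4] eq by (simp_all add: ans_def)
    show "F 2 = F' 2"
      by (rule decode_snd[OF F4]) (use ij r in auto)
  qed (use e k w \<X> \<beta> in auto)
  have cardA: "card (f ` \<X>) = card \<X>" using f by (simp add: card_image)
  have "card (answer_alphabet scheme l) \<le> card \<X> ^ \<beta>" for l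
  proof -
    \<comment> \<open>Only the lengths 6 and \<open>n + 2 = \<beta> - 1\<close> occur. Each
      contributes at most \<open>card \<X> ^ (\<beta> - 1)\<close> words, and doubling is absorbed
      by one more factor \<open>card \<X>\<close>.\<close>
    have "answer_alphabet scheme l \<subseteq> words 6 (f ` \<X>) \<union> words (n + 2) (f ` \<X>)"
      unfolding answer_alphabet_scheme by (auto simp: len_def split: if_splits)
    then have "card (answer_alphabet scheme l) \<le> card (words 6 (f ` \<X>) \<union> words (n + 2) (f ` \<X>))"
      by (rule card_mono[rotated]) (use \<X> in \<open>auto simp: finite_words\<close>)
    also have "\<dots> \<le> card (words 6 (f ` \<X>)) + card (words (n + 2) (f ` \<X>))"
      by (rule card_Un_le)
    also have "\<dots> = card \<X> ^ 6 + card \<X> ^ (n + 2)"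
      using \<X> by (simp add: card_words cardA)
    also have "\<dots> \<le> card \<X> ^ (n + 2) + card \<X> ^ (n + 2)"
      using \<X> \<beta>n(2) by (intro add_right_mono power_increasing) auto
    also have "\<dots> = 2 * card \<X> ^ (n + 2)" by simp
    also have "\<dots> \<le> card \<X> * card \<X> ^ (n + 2)"
      using \<X> by (intro mult_right_mono) auto
    also have "\<dots> = card \<X> ^ \<beta>" by (simp add: \<beta>n eval_nat_numeral)
    finally show ?thesis .
  qed
  then have "scheme \<in> wpir_2_2 answer_alphabet \<X> \<alpha> \<beta>"
    by (intro scheme_in_wpir_2_2 \<alpha>)
  \<comment> \<open>A cheap pair of answers has 6 + (n + 2) = \<beta> + 5 symbols, any other pair 2
    (n + 2) = 2 (\<beta> - 1).\<close>
  moreover have "rate scheme = \<beta> / ((real \<beta> + 5) * (w 0 + w 1) + 2 * (real \<beta> - 1) * (w 2 + w 3))"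
  proof -
    have "0 < log 2 (card \<X>)" using \<X> by simp
    moreover have "download_cost scheme =
        log 2 (card \<X>) * ((real \<beta> + 5) * (w 0 + w 1) + 2 * (real \<beta> - 1) * (w 2 + w 3))"
      by (subst download_cost_scheme) (simp_all add: len_def cardA \<beta>n algebra_simps)
    ultimately show ?thesis unfolding rate_def by simp
  qed
  ultimately show ?thesis using leakage_scheme by blast
qed

text \<open>All cases of the theorem reduce to a choice of weights and a matching upper bound. The
  constraint \<open>L\<close> is accessed through the two leakages, which the exact and the
  approximate scheme share.\<close>

lemma is_max_rateI:
  fixes \<X> :: "'x set" and w :: "nat \<Rightarrow> real"
    and L :: "('s::infinite, 'q::infinite, 'x, 'a::infinite) ir_scheme \<Rightarrow> bool"
  assumes \<X>: "finite \<X>" "2 \<le> card \<X>" and \<alpha>: "4 \<le> \<alpha>"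
    and w: "0 \<le> w 0" "0 \<le> w 1" "0 \<le> w 2" "0 \<le> w 3" "w 0 + w 1 + w 2 + w 3 = 1"
    and c: "c = inverse (1 + w 2 + w 3)"
    and L: "\<And>C. num_servers C = 2 \<Longrightarrow>
      leakage C 1 = log 2 (w 0 + 2 * max (w 1) (w 2) + w 3) \<Longrightarrow>
      leakage C 2 = log 2 (w 1 + w 2 + 2 * max (w 0) (w 3)) \<Longrightarrow> L C"
    and le: "\<And>\<beta> C. C \<in> wpir_2_2 transmitted_answers \<X> \<alpha> \<beta> \<Longrightarrow> L C \<Longrightarrow> rate C \<le> c"
  shows "is_max_rate \<X> \<alpha> L c"
  unfolding is_max_rate_def
proof (intro conjI allI impI ballI)
  show "rate C \<le> c" if "C \<in> wpir_2_2 answer_alphabet \<X> \<alpha> \<beta>" "L C" for \<beta> C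
    using that wpir_2_2_answer_alphabet_subset le by blast
  show "rate C \<le> c" if "C \<in> wpir_2_2 transmitted_answers \<X> \<alpha> \<beta>" "L C" for \<beta> C
    using that le by blast
  show "\<exists>C\<in>wpir_2_2 transmitted_answers \<X> \<alpha> \<beta>. L C \<and> rate C = c" if \<beta>: "1 \<le> \<beta>" for \<beta>
  proof -
    obtain C :: "('s, 'q, 'x, 'a) ir_scheme" where C: "C \<in> wpir_2_2 transmitted_answers \<X> \<alpha> \<beta>"
      "leakage C 1 = log 2 (w 0 + 2 * max (w 1) (w 2) + w 3)"
      "leakage C 2 = log 2 (w 1 + w 2 + 2 * max (w 0) (w 3))" "rate C = c"
      using exact_scheme_exists[where ?'s = 's and ?'q = 'q and ?'a = 'a, OF \<X> \<beta> \<alpha> w]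
      unfolding c by blast
    then have "L C" by (intro L) (auto simp: wpir_2_2_def)
    then show ?thesis using C by blast
  qed
  \<comment> \<open>The approximate scheme downloads \<beta> u + v symbols on average, where
    \<open>v\<close> does not depend on \<beta>, so its rate tends to 1 / \<open>u\<close>.\<close>
  define u where "u = 1 + w 2 + w 3"
  define v where "v = 5 * (w 0 + w 1) - 2 * (w 2 + w 3)"
  have "\<forall>\<beta>. \<exists>C :: ('s, 'q, 'x, 'a) ir_scheme. 7 \<le> \<beta> \<longrightarrow>
      C \<in> wpir_2_2 answer_alphabet \<X> \<alpha> \<beta> \<and> L C \<and> rate C = \<beta> / (\<beta> * u + v)"
  proof (intro allI)
    fix \<beta>
    show "\<exists>C :: ('s, 'q, 'x, 'a) ir_scheme. 7 \<le> \<beta> \<longrightarrow>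
      C \<in> wpir_2_2 answer_alphabet \<X> \<alpha> \<beta> \<and> L C \<and> rate C = \<beta> / (\<beta> * u + v)"
    proof (cases "7 \<le> \<beta>")
      case True
      obtain C :: "('s, 'q, 'x, 'a) ir_scheme" where C: "C \<in> wpir_2_2 answer_alphabet \<X> \<alpha> \<beta>"
        "leakage C 1 = log 2 (w 0 + 2 * max (w 1) (w 2) + w 3)"
        "leakage C 2 = log 2 (w 1 + w 2 + 2 * max (w 0) (w 3))"
        "rate C = \<beta> / ((real \<beta> + 5) * (w 0 + w 1) + 2 * (real \<beta> - 1) * (w 2 + w 3))"
        using approximate_scheme_exists[where ?'s = 's and ?'q = 'q and ?'a = 'a, OF \<X> True \<alpha> w]
        by (elim bexE conjE)
      have "L C" using C by (intro L) (auto simp: wpir_2_2_def)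
      moreover have "(real \<beta> + 5) * (w 0 + w 1) + 2 * (real \<beta> - 1) * (w 2 + w 3) = \<beta> * u + v"
      proof -
        have eq: "w 0 + w 1 = 1 - w 2 - w 3" using w(5) by simp
        show ?thesis unfolding u_def v_def eq by (simp add: algebra_simps)
      qed
      ultimately show ?thesis using C by metis
    qed simp
  qed
  then obtain C :: "nat \<Rightarrow> ('s, 'q, 'x, 'a) ir_scheme" where
    C: "\<And>\<beta>. 7 \<le> \<beta> \<Longrightarrow> C \<beta> \<in> wpir_2_2 answer_alphabet \<X> \<alpha> \<beta> \<and> L (C \<beta>) \<and> rate (C \<beta>) = \<beta> / (\<beta> * u + v)"
    by metis
  have "u > 0" using w by (simp add: u_def)
  have "(\<lambda>\<beta>. inverse (u + v / real \<beta>)) \<longlonglongrightarrow> inverse (u + 0)"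
    using \<open>u > 0\<close> by (intro tendsto_intros lim_const_over_n) auto
  moreover have "\<forall>\<^sub>F \<beta> in sequentially. inverse (u + v / real \<beta>) = rate (C \<beta>)"
    using eventually_ge_at_top[of 7]
  proof eventually_elim
    case (elim \<beta>)
    then have "u + v / real \<beta> = (\<beta> * u + v) / \<beta>" by (simp add: field_simps)
    then show ?case using C[OF elim] by (simp add: inverse_divide)
  qed
  ultimately have "(\<lambda>\<beta>. rate (C \<beta>)) \<longlonglongrightarrow> c"
    unfolding c u_def[symmetric] by (simp add: tendsto_cong)
  moreover have "\<forall>\<^sub>F \<beta> in sequentially. C \<beta> \<in> wpir_2_2 answer_alphabet \<X> \<alpha> \<beta> \<and> L (C \<beta>)"
    using eventually_ge_at_top[of 7] by eventually_elim (use C in blast)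
  ultimately show "\<exists>C. (\<forall>\<^sub>F \<beta> in sequentially. C \<beta> \<in> wpir_2_2 answer_alphabet \<X> \<alpha> \<beta> \<and> L (C \<beta>)) \<and>
      (\<lambda>\<beta>. rate (C \<beta>)) \<longlonglongrightarrow> c"
    by blast
qed

theorem theorem11:
  fixes \<X> :: "'x set" and \<rho> :: real
  assumes "finite \<X>" and "2 \<le> card \<X>" and "0 \<le> \<rho>" and "\<rho> \<le> 1"
  shows "\<exists>\<alpha>\<^sub>0>0. \<forall>\<alpha>\<ge>\<alpha>\<^sub>0.
    (\<rho> \<le> log 2 (3 / 2) \<longrightarrow>
       is_max_rate \<X> \<alpha>
         (\<lambda>C :: ('s::infinite, 'q::infinite, 'x, 'a::infinite) ir_scheme. max_leakage C \<le> \<rho>)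
         (inverse (5 / 2 - 2 powr \<rho>))) \<and>
    (log 2 (3 / 2) < \<rho> \<longrightarrow>
       is_max_rate \<X> \<alpha>
         (\<lambda>C :: ('s, 'q, 'x, 'a) ir_scheme. max_leakage C \<le> \<rho>)
         1) \<and>
    is_max_rate \<X> \<alpha>
      (\<lambda>C :: ('s, 'q, 'x, 'a) ir_scheme.
         max_leakage C \<le> \<rho> \<and> (leakage C 1 = 0 \<or> leakage C 2 = 0))
      (inverse (2 - 2 powr (\<rho> - 1)))"
proof (intro exI[of _ 4] conjI allI impI)
  \<comment> \<open>The schemes have four query codes, so query alphabets of size 4 suffice.\<close>
  fix \<alpha> :: nat assume \<alpha>: "4 \<le> \<alpha>"
  define t where "t = 2 powr \<rho>"
  have t: "1 \<le> t" "t \<le> 2" "log 2 t = \<rho>"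
    using assms(3,4) powr_mono[of \<rho> 1 2] by (simp_all add: t_def ge_one_powr_ge_zero)
  have leak: "2 powr leakage C 1 \<le> t" "2 powr leakage C 2 \<le> t"
    if "C \<in> wpir_2_2 alph \<X> \<alpha> \<beta>" "max_leakage C \<le> \<rho>"
    for C :: "('s, 'q, 'x, 'a) ir_scheme" and alph \<beta>
    using that by (auto simp: t_def wpir_2_2_def max_leakage_eq)
  show "is_max_rate \<X> \<alpha> (\<lambda>C :: ('s, 'q, 'x, 'a) ir_scheme. max_leakage C \<le> \<rho>)
      (inverse (5 / 2 - 2 powr \<rho>))" if "\<rho> \<le> log 2 (3 / 2)"
  proof -
    have t32: "t \<le> 3 / 2" using that by (simp add: t_def le_log_iff)
    \<comment> \<open>With \<open>w 0\<close> = \<open>w 1\<close> = p >= 1/4 and \<open>w 2\<close>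
      = \<open>w 3\<close> = 1/2 - p, two to the leakage is 1/2 + 2 p at both servers. Equating this
      with \<open>t\<close> gives the weights; the last two are nonnegative just for
      \<open>t\<close> <= 3/2.\<close>
    let ?w = "(!) [(t - 1/2) / 2, (t - 1/2) / 2, (3/2 - t) / 2, (3/2 - t) / 2]"
    show ?thesis
    proof (rule is_max_rateI[OF assms(1,2) \<alpha>, of ?w])
      show "inverse (5 / 2 - 2 powr \<rho>) = inverse (1 + ?w 2 + ?w 3)"
        by (rule arg_cong[where f = inverse]) (simp add: t_def field_simps)
      show "max_leakage C \<le> \<rho>" if "num_servers C = 2"
        "leakage C 1 = log 2 (?w 0 + 2 * max (?w 1) (?w 2) + ?w 3)"
        "leakage C 2 = log 2 (?w 1 + ?w 2 + 2 * max (?w 0) (?w 3))"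
        for C :: "('s, 'q, 'x, 'a) ir_scheme"
      proof -
        have "?w 0 + 2 * max (?w 1) (?w 2) + ?w 3 = t" "?w 1 + ?w 2 + 2 * max (?w 0) (?w 3) = t"
          using t t32 by (simp_all add: max_def field_simps)
        then have "leakage C 1 = \<rho>" "leakage C 2 = \<rho>" using that t(3) by (simp_all only:)
        then show ?thesis using that(1) by (simp add: max_leakage_eq)
      qed
      show "rate C \<le> inverse (5 / 2 - 2 powr \<rho>)"
        if C: "C \<in> wpir_2_2 transmitted_answers \<X> \<alpha> \<beta>" and "max_leakage C \<le> \<rho>"
        for \<beta> and C :: "('s, 'q, 'x, 'a) ir_scheme"
      proof -
        have "5 / 2 - t \<le> 5 / 2 - (2 powr leakage C 1 + 2 powr leakage C 2) / 2" (is "_ \<le> ?D")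
          using leak[OF that] by (simp add: field_simps)
        moreover have "0 < 5 / 2 - t" using t32 by simp
        ultimately have "rate C \<le> inverse ?D" "inverse ?D \<le> inverse (5 / 2 - t)"
          by (intro rate_le(2)[OF C] le_imp_inverse_le; linarith)+
        then show ?thesis by (simp add: t_def)
      qed
    qed (use t t32 in \<open>simp_all add: field_simps\<close>)
  qed
  \<comment> \<open>At leakage log 2 (3/2) the expensive pairs are already gone and the rate is 1,
    which no scheme exceeds. Beyond that point the optimum stays constant.\<close>
  show "is_max_rate \<X> \<alpha> (\<lambda>C :: ('s, 'q, 'x, 'a) ir_scheme. max_leakage C \<le> \<rho>) 1"
    if "log 2 (3 / 2) < \<rho>"
    by (rule is_max_rateI[OF assms(1,2) \<alpha>, of "(!) [1/2, 1/2, 0, 0]"])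
      (use that rate_le(1) in \<open>auto simp: max_leakage_eq\<close>)
  \<comment> \<open>Privacy of server 2 forces \<open>w 0\<close> = \<open>w 3\<close>, and
    \<open>t\<close> at server 1 forces \<open>w 0\<close> + \<open>w 1\<close> = t / 2. The cost 2
    - t / 2 is then fixed; taking \<open>w 2\<close> = \<open>w 0\<close> keeps all weights
    nonnegative for 1 <= t <= 2.\<close>
  let ?w = "(!) [(2 - t) / 4, (3 * t - 2) / 4, (2 - t) / 4, (2 - t) / 4]"
  have half: "2 powr (\<rho> - 1) = t / 2" by (simp add: t_def powr_diff)
  show "is_max_rate \<X> \<alpha> (\<lambda>C :: ('s, 'q, 'x, 'a) ir_scheme.
      max_leakage C \<le> \<rho> \<and> (leakage C 1 = 0 \<or> leakage C 2 = 0)) (inverse (2 - 2 powr (\<rho> - 1)))"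
  proof (rule is_max_rateI[OF assms(1,2) \<alpha>, of ?w])
    show "inverse (2 - 2 powr (\<rho> - 1)) = inverse (1 + ?w 2 + ?w 3)"
      by (rule arg_cong[where f = inverse]) (simp add: half field_simps)
    show "max_leakage C \<le> \<rho> \<and> (leakage C 1 = 0 \<or> leakage C 2 = 0)" if "num_servers C = 2"
      "leakage C 1 = log 2 (?w 0 + 2 * max (?w 1) (?w 2) + ?w 3)"
      "leakage C 2 = log 2 (?w 1 + ?w 2 + 2 * max (?w 0) (?w 3))"
      for C :: "('s, 'q, 'x, 'a) ir_scheme"
    proof -
      have "?w 0 + 2 * max (?w 1) (?w 2) + ?w 3 = t" "?w 1 + ?w 2 + 2 * max (?w 0) (?w 3) = 1"
        using t by (simp_all add: max_def field_simps)
      then have "leakage C 1 = \<rho>" "leakage C 2 = log 2 1" using that t(3) by (simp_all only:)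
      then show ?thesis using that(1) assms(3) by (simp add: max_leakage_eq)
    qed
    show "rate C \<le> inverse (2 - 2 powr (\<rho> - 1))"
      if C: "C \<in> wpir_2_2 transmitted_answers \<X> \<alpha> \<beta>"
        and L: "max_leakage C \<le> \<rho> \<and> (leakage C 1 = 0 \<or> leakage C 2 = 0)"
      for \<beta> and C :: "('s, 'q, 'x, 'a) ir_scheme"
    proof -
      \<comment> \<open>The private server, whichever it is, contributes 1 and the other one at most
        \<open>t\<close>, so the sum is at most 1 + t.\<close>
      have "2 - t / 2 \<le> 5 / 2 - (2 powr leakage C 1 + 2 powr leakage C 2) / 2" (is "_ \<le> ?D")
        using leak[OF C] L by (auto simp: field_simps)
      moreover have "0 < 2 - t / 2" using t by simp
      ultimately have "rate C \<le> inverse ?D" "inverse ?D \<le> inverse (2 - t / 2)"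
        by (intro rate_le(2)[OF C] le_imp_inverse_le; linarith)+
      then show ?thesis by (simp add: half)
    qed
  qed (use t in \<open>simp_all add: field_simps\<close>)
qed simp

end
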